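(* Let $F$ be an algebraically closed field of characteristic $p>0$, let $G$ be a finite group and let $Q$ be a normal $p$-subgroup of $G$. Let $G_p$ denote the set of $p$-elements of $G$ and $G_p^+ := \sum_{x\in G_p} x \in FG$. Then the number of blocks of defect zero of the group algebra $F[G/Q]$ equals the $F$-dimension of the ideal $\mathrm{W}_Q(FG) := \mathrm{Tr}_Q^G(FG\cdot G_p^+)$ of the center $\mathrm{Z}(FG)$.
   Context: For a subgroup $X$ of $G$, $(FG)^X := \{a\in FG : xax^{-1}=a \text{ for all } x\in X\}$. For subgroups $Y\le X\le G$, the relative trace map $\mathrm{Tr}_Y^X:(FG)^Y\to (FG)^X$ is defined by $a\mapsto \sum_{xY\in X/Y} xax^{-1}$ (sum over a set of left coset representatives). Note $FG\cdot G_p^+\subseteq (FG)^Q$ since $uG_p^+=G_p^+$ for $u\in Q$. *)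

theory Defs
  imports "HOL-Algebra.Coset" "HOL-Algebra.Multiplicative_Group" "HOL-Library.Function_Algebras" "HOL-Computational_Algebra.Polynomial"
begin

definition alg_closed :: "'f::field itself \<Rightarrow> bool" where
  "alg_closed _ \<longleftrightarrow> (\<forall>q :: 'f poly. degree q > 0 \<longrightarrow> (\<exists>x. poly q x = 0))"

text \<open>Elements of FH are functions carrier H to F, extended by 0 outside the carrier;
  the element a corresponds to the sum over h of a(h) h.\<close>

definition group_alg :: "('g, 'm) monoid_scheme \<Rightarrow> ('g \<Rightarrow> 'f::field) set" where
  "group_alg H = {a. \<forall>x. x \<notin> carrier H \<longrightarrow> a x = 0}"

definition ga_mult :: "('g, 'm) monoid_scheme \<Rightarrow> ('g \<Rightarrow> 'f::field) \<Rightarrow> ('g \<Rightarrow> 'f) \<Rightarrow> ('g \<Rightarrow> 'f)" where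
  "ga_mult H a b = (\<lambda>x. if x \<in> carrier H
      then (\<Sum>y\<in>carrier H. a y * b (inv\<^bsub>H\<^esub> y \<otimes>\<^bsub>H\<^esub> x)) else 0)"

text \<open>Conjugation: x a x^{-1}; its coefficient at h is a(x^{-1} h x).\<close>
definition ga_conj :: "('g, 'm) monoid_scheme \<Rightarrow> 'g \<Rightarrow> ('g \<Rightarrow> 'f::field) \<Rightarrow> ('g \<Rightarrow> 'f)" where
  "ga_conj H x a = (\<lambda>h. if h \<in> carrier H then a (inv\<^bsub>H\<^esub> x \<otimes>\<^bsub>H\<^esub> h \<otimes>\<^bsub>H\<^esub> x) else 0)"

definition ga_fixed :: "('g, 'm) monoid_scheme \<Rightarrow> 'g set \<Rightarrow> ('g \<Rightarrow> 'f::field) set" where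
  "ga_fixed H X = {a \<in> group_alg H. \<forall>x\<in>X. ga_conj H x a = a}"

definition rel_trace :: "('g, 'm) monoid_scheme \<Rightarrow> 'g set \<Rightarrow> 'g set \<Rightarrow> ('g \<Rightarrow> 'f::field) \<Rightarrow> ('g \<Rightarrow> 'f)" where
  "rel_trace H Y X a = (\<lambda>h. \<Sum>C\<in>{x <#\<^bsub>H\<^esub> Y | x. x \<in> X}. ga_conj H (SOME x. x \<in> C) a h)"

definition ga_center :: "('g, 'm) monoid_scheme \<Rightarrow> ('g \<Rightarrow> 'f::field) set" where
  "ga_center H = {z \<in> group_alg H. \<forall>a\<in>group_alg H. ga_mult H z a = ga_mult H a z}"

definition central_idem :: "('g, 'm) monoid_scheme \<Rightarrow> ('g \<Rightarrow> 'f::field) \<Rightarrow> bool" where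
  "central_idem H e \<longleftrightarrow> e \<in> ga_center H \<and> ga_mult H e e = e"

definition block_idem :: "('g, 'm) monoid_scheme \<Rightarrow> ('g \<Rightarrow> 'f::field) \<Rightarrow> bool" where
  "block_idem H e \<longleftrightarrow> central_idem H e \<and> e \<noteq> (\<lambda>_. 0) \<and>
     \<not> (\<exists>e1 e2. central_idem H e1 \<and> central_idem H e2 \<and> e1 \<noteq> (\<lambda>_. 0) \<and> e2 \<noteq> (\<lambda>_. 0)
            \<and> ga_mult H e1 e2 = (\<lambda>_. 0) \<and> e = (\<lambda>g. e1 g + e2 g))"

definition defect_group :: "('g, 'm) monoid_scheme \<Rightarrow> ('g \<Rightarrow> 'f::field) \<Rightarrow> 'g set \<Rightarrow> bool" where
  "defect_group H e P \<longleftrightarrow> subgroup P H \<and> e \<in> rel_trace H P (carrier H) ` ga_fixed H P \<and>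
     (\<forall>R. subgroup R H \<and> R \<subseteq> P \<and> e \<in> rel_trace H R (carrier H) ` ga_fixed H R \<longrightarrow> R = P)"

definition defect_zero_block :: "('g, 'm) monoid_scheme \<Rightarrow> ('g \<Rightarrow> 'f::field) \<Rightarrow> bool" where
  "defect_zero_block H e \<longleftrightarrow> block_idem H e \<and> defect_group H e {\<one>\<^bsub>H\<^esub>}"

definition p_elements :: "('g, 'm) monoid_scheme \<Rightarrow> nat \<Rightarrow> 'g set" where
  "p_elements H p = {x \<in> carrier H. \<exists>k. group.ord H x = p ^ k}"

definition p_elem_sum :: "('g, 'm) monoid_scheme \<Rightarrow> nat \<Rightarrow> ('g \<Rightarrow> 'f::field)" where
  "p_elem_sum H p = (\<lambda>x. if x \<in> p_elements H p then 1 else 0)"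

definition W_ideal :: "('g, 'm) monoid_scheme \<Rightarrow> nat \<Rightarrow> 'g set \<Rightarrow> ('g \<Rightarrow> 'f::field) set" where
  "W_ideal G p Q = rel_trace G Q (carrier G) ` {ga_mult G a (p_elem_sum G p) | a. a \<in> group_alg G}"

definition fdim :: "('g \<Rightarrow> 'f::field) set \<Rightarrow> nat" where
  "fdim S = vector_space.dim (\<lambda>(c::'f) (a::'g \<Rightarrow> 'f) x. c * a x) S"

end

theory Submission
  imports Defs "HOL-Computational_Algebra.Primes"
begin

text \<open>
  Put \<open>H = G/Q\<close>. Since \<open>Q\<close> is a normal \<open>p\<close>-subgroup, \<open>G_p\<close> is the full preimage of \<open>H_p\<close>, and
  inflation along \<open>G \<rightarrow> H\<close> maps \<open>Tr_1^H(FH \<cdot> H_p^+)\<close> isomorphically onto \<open>W_Q(FG)\<close>. So let \<open>Q = 1\<close>,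
  and write \<open>\<theta> = H_p^+\<close>, \<open>I = Tr_1^H(FH)\<close> and \<open>\<tau>(a)\<close> for the coefficient of \<open>a\<close> at \<open>1\<close>; then
  \<open>W = I\<theta>\<close>, and a block has defect zero iff its idempotent lies in \<open>I\<close>.

  Counting modulo \<open>p\<close> the words, respectively closed walks, of length \<open>q = p\<^sup>n\<close> up to rotation
  gives, for large \<open>n\<close>, \<open>\<tau>(a\<theta>)\<^sup>q = \<tau>(a\<^sup>q)\<close> and \<open>\<tau>(x Tr(b))\<^sup>q = \<tau>(x\<^sup>q Tr(b\<^sup>q))\<close>. By the first identity
  nilpotent central elements annihilate \<open>\<theta>\<close>. By the second one, if \<open>e = Tr(b)\<close> is a block idempotent
  then \<open>eZ\<close> has no nonzero nilpotent elements, so \<open>eZ = Fe\<close>; combining both, \<open>e\<theta> \<noteq> 0\<close>. As every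
  element of \<open>I\<close> is a combination of the block idempotents in \<open>I\<close> and a nilpotent element, the
  products \<open>e\<theta>\<close> with \<open>e\<close> a block idempotent in \<open>I\<close> form a basis of \<open>I\<theta>\<close>.
\<close>

section \<open>Rotation of words modulo p\<close>

lemma funpow_period:
  fixes s :: "'a \<Rightarrow> 'a"
  assumes "(s ^^ d) x = x"
  shows "(s ^^ (d * k)) x = x"
  using assms by (induction k) (simp_all add: funpow_add)

text \<open>Two coinciding iterates would give a period \<open>d\<close> of \<open>x\<close> with
  \<open>0 < d < p\<close>. It is coprime to \<open>p\<close>, so by Bezout a multiple of
  \<open>d\<close> exceeds a multiple of \<open>p\<close> by 1, and \<open>x\<close> would be
  fixed.\<close>

lemma inj_on_prime_orbit:
  fixes s :: "'a \<Rightarrow> 'a"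
  assumes p: "prime p" and per: "(s ^^ p) x = x" and nfix: "s x \<noteq> x"
  shows "inj_on (\<lambda>i. (s ^^ i) x) {..<p}"
proof (rule linorder_inj_onI)
  fix i j assume ij: "i < j" "i \<in> {..<p}" "j \<in> {..<p}"
  show "(s ^^ i) x \<noteq> (s ^^ j) x"
  proof
    assume eq: "(s ^^ i) x = (s ^^ j) x"
    define d where "d = j - i"
    \<comment> \<open>Advancing both sides by \<open>p - i\<close> returns the left one to
      \<open>x\<close> and turns the coincidence into a period of \<open>x\<close> itself.\<close>
    have "(s ^^ (p - i)) ((s ^^ i) x) = (s ^^ (p - i)) ((s ^^ j) x)"
      using eq by simp
    moreover have "p - i + i = p" "p - i + j = d + p"
      using ij by (auto simp: d_def)
    ultimately have "(s ^^ p) x = (s ^^ (d + p)) x"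
      by (metis comp_apply funpow_add)
    then have d: "(s ^^ d) x = x"
      using per by (simp add: funpow_add)
    have "0 < d" "d < p" using ij by (auto simp: d_def)
    then have "coprime d p"
      using p by (metis coprime_commute nat_dvd_not_less prime_imp_coprime)
    then obtain u v where "d * u = p * v + 1"
      using \<open>0 < d\<close> bezout_nat[of d p] by (metis coprime_imp_gcd_eq_1 not_gr_zero)
    then have "s ((s ^^ (p * v)) x) = (s ^^ (d * u)) x"
      by simp
    then show False
      using nfix funpow_period[OF d] funpow_period[OF per] by simp
  qed
qed auto

text \<open>The set splits into orbits of exactly \<open>p\<close> elements on which
  \<open>f\<close> is constant, and each contributes a multiple of \<open>p\<close>. The induction
  removes one orbit at a time.\<close>

lemma sum_invariant_fixed_point_free:
  fixes f :: "'a \<Rightarrow> 'f::comm_ring_1"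
  assumes p: "prime p" and char: "of_nat p = (0::'f)"
    and "finite X" "s ` X \<subseteq> X"
    and "\<And>x. x \<in> X \<Longrightarrow> (s ^^ p) x = x" "\<And>x. x \<in> X \<Longrightarrow> f (s x) = f x"
    and "\<And>x. x \<in> X \<Longrightarrow> s x \<noteq> x"
  shows "sum f X = 0"
  using assms(3-)
proof (induction X rule: finite_psubset_induct)
  case (psubset X)
  show ?case
  proof (cases "X = {}")
    case False
    then obtain x where x: "x \<in> X" by blast
    define O1 where "O1 = (\<lambda>i. (s ^^ i) x) ` {..<p}"
    have it: "(s ^^ i) x \<in> X \<and> f ((s ^^ i) x) = f x" for i
      by (induction i) (use x psubset.prems in auto)
    have sub: "O1 \<subseteq> X" using it by (auto simp: O1_def)
    \<comment> \<open>The orbit also contains the preimages of its points, hence \<open>s\<close>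
      maps its complement in \<open>X\<close> into itself.\<close>
    have preimage: "y \<in> O1" if y: "y \<in> X" "s y \<in> O1" for y
    proof -
      from y obtain i where i: "s y = (s ^^ i) x" by (auto simp: O1_def)
      have pp: "p > 0" using p by (simp add: prime_gt_0_nat)
      have "y = (s ^^ p) y" using y psubset.prems by simp
      also have "\<dots> = (s ^^ (p - 1)) (s y)"
        using pp by (metis Suc_diff_1 comp_apply funpow_Suc_right)
      also have "\<dots> = (s ^^ (p - 1 + i)) x" by (simp add: i funpow_add)
      also have "\<dots> = (s ^^ ((p - 1 + i) mod p)) ((s ^^ (p * ((p - 1 + i) div p))) x)"
        by (metis comp_apply funpow_add mod_mult_div_eq)
      also have "\<dots> = (s ^^ ((p - 1 + i) mod p)) x"
        using funpow_period[of p s x] x psubset.prems by simp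
      finally show ?thesis using pp by (auto simp: O1_def)
    qed
    have inj: "inj_on (\<lambda>i. (s ^^ i) x) {..<p}"
      by (rule inj_on_prime_orbit[OF p psubset.prems(2)[OF x] psubset.prems(4)[OF x]])
    have "sum f O1 = (\<Sum>i<p. f x)"
      using it by (simp add: O1_def sum.reindex[OF inj])
    then have "sum f O1 = 0" by (simp add: char)
    moreover have "sum f (X - O1) = 0"
    proof (rule psubset.IH)
      have "x \<in> O1"
        unfolding O1_def using p by (intro image_eqI[of _ _ 0]) (auto simp: prime_gt_0_nat)
      then show "X - O1 \<subset> X" using x by blast
      show "s ` (X - O1) \<subseteq> X - O1"
        using preimage psubset.prems(1) by blast
    qed (use psubset.prems in auto)
    moreover have "sum f X = sum f (X - O1) + sum f O1"
      using sub psubset.hyps by (rule sum.subset_diff)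
    ultimately show ?thesis by simp
  qed simp
qed

text \<open>Induction on \<open>n\<close>: the map \<open>r = s ^^ (p ^ n)\<close> has period
  \<open>p\<close>, so the points it moves cancel, while on the points it fixes the induction
  hypothesis applies to \<open>s\<close>.\<close>

lemma sum_invariant_eq_sum_fixed_points:
  fixes f :: "'a \<Rightarrow> 'f::comm_ring_1"
  assumes p: "prime p" and char: "of_nat p = (0::'f)"
    and "finite X" "s ` X \<subseteq> X"
    and "\<And>x. x \<in> X \<Longrightarrow> (s ^^ (p ^ n)) x = x" "\<And>x. x \<in> X \<Longrightarrow> f (s x) = f x"
  shows "sum f X = sum f {x \<in> X. s x = x}"
  using assms(3-)
proof (induction n arbitrary: X)
  case 0
  then have "{x \<in> X. s x = x} = X" by auto
  then show ?case by simp
next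
  case (Suc n)
  define r where "r = s ^^ (p ^ n)"
  have it: "(s ^^ i) x \<in> X \<and> f ((s ^^ i) x) = f x" if "x \<in> X" for i x
    by (induction i) (use that Suc.prems in auto)
  have comm: "r (s x) = s (r x)" for x
    unfolding r_def by (metis funpow_swap1)
  have rp: "(r ^^ p) x = x" if "x \<in> X" for x
    using Suc.prems(3)[OF that] by (simp add: r_def funpow_mult mult.commute)
  have "sum f {x \<in> X. r x \<noteq> x} = 0"
  proof (rule sum_invariant_fixed_point_free[OF p char, where s = r])
    \<comment> \<open>If \<open>r\<close> fixed \<open>r x\<close>, all later iterates would equal
      \<open>r x\<close>, yet the one of index \<open>p\<close> is \<open>x\<close>.\<close>
    have "r (r x) \<noteq> r x" if x: "x \<in> X" "r x \<noteq> x" for x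
    proof
      assume eq: "r (r x) = r x"
      have "(r ^^ Suc k) x = r x" for k
        by (induction k) (use eq in auto)
      then show False
        using rp[OF x(1)] x(2) p by (metis Suc_diff_1 prime_gt_0_nat)
    qed
    then show "r ` {x \<in> X. r x \<noteq> x} \<subseteq> {x \<in> X. r x \<noteq> x}"
      using it by (auto simp: r_def)
  qed (use Suc.prems rp it in \<open>auto simp: r_def\<close>)
  moreover have "sum f {x \<in> X. r x = x} = sum f {x \<in> {x \<in> X. r x = x}. s x = x}"
  proof (rule Suc.IH)
    show "s ` {x \<in> X. r x = x} \<subseteq> {x \<in> X. r x = x}"
      using Suc.prems(2) comm by auto
  qed (use Suc.prems in \<open>auto simp: r_def\<close>)
  moreover have "{x \<in> {x \<in> X. r x = x}. s x = x} = {x \<in> X. s x = x}"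
  proof -
    have "r x = x" if "s x = x" for x
      unfolding r_def using funpow_period[of 1 s x "p ^ n"] that by simp
    then show ?thesis by auto
  qed
  moreover have "sum f X = sum f {x \<in> X. r x = x} + sum f {x \<in> X. r x \<noteq> x}"
  proof -
    have "X = {x \<in> X. r x = x} \<union> {x \<in> X. r x \<noteq> x}" by auto
    then have "sum f X = sum f ({x \<in> X. r x = x} \<union> {x \<in> X. r x \<noteq> x})" by simp
    also have "\<dots> = sum f {x \<in> X. r x = x} + sum f {x \<in> X. r x \<noteq> x}"
      by (rule sum.union_disjoint) (use Suc.prems(1) in auto)
    finally show ?thesis .
  qed
  ultimately show ?case by simp
qed

section \<open>Words over a finite alphabet and their rotations\<close>

definition words :: "'a set \<Rightarrow> nat \<Rightarrow> 'a list set" where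
  "words X n = {w. set w \<subseteq> X \<and> length w = n}"

lemma finite_words [simp]: "finite X \<Longrightarrow> finite (words X n)"
  by (simp add: words_def finite_lists_length_eq)

lemma words_0 [simp]: "words X 0 = {[]}"
  by (auto simp: words_def)

lemma sum_words_Suc:
  "(\<Sum>w\<in>words X (Suc n). f w) = (\<Sum>x\<in>X. \<Sum>w\<in>words X n. f (x # w))"
proof -
  have "words X (Suc n) = (\<lambda>(x, w). x # w) ` (X \<times> words X n)"
    by (auto simp: words_def length_Suc_conv image_iff)
  moreover have "inj_on (\<lambda>(x, w). x # w) (X \<times> words X n)"
    by (auto simp: inj_on_def)
  ultimately show ?thesis
    by (simp add: sum.reindex sum.cartesian_product case_prod_unfold)
qed

lemma rotate1_fixed_replicate:
  assumes "rotate1 w = w"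
  shows "w = replicate (length w) (hd w)"
proof (cases w)
  case (Cons x xs)
  then have "xs @ [x] = x # xs" using assms by simp
  then have "xs = replicate (length xs) x"
    by (induction xs) auto
  then show ?thesis using Cons by simp
qed simp

text \<open>Rotating a word of length \<open>p ^ n\<close> that many times restores it, and the
  words fixed by rotation are the constant ones.\<close>

lemma sum_words_rotation_invariant:
  fixes f :: "'a list \<Rightarrow> 'f::comm_ring_1"
  assumes p: "prime p" and char: "of_nat p = (0::'f)" and fin: "finite X"
    and inv: "\<And>w. w \<in> words X (p ^ n) \<Longrightarrow> f (rotate1 w) = f w"
  shows "(\<Sum>w\<in>words X (p ^ n). f w) = (\<Sum>x\<in>X. f (replicate (p ^ n) x))"
proof -
  have pos: "p ^ n > 0" using p by (simp add: prime_gt_0_nat)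
  have "(\<Sum>w\<in>words X (p ^ n). f w) = sum f {w \<in> words X (p ^ n). rotate1 w = w}"
  proof (rule sum_invariant_eq_sum_fixed_points[OF p char])
    show "(rotate1 ^^ p ^ n) w = w" if "w \<in> words X (p ^ n)" for w
      using rotate_id[of "p ^ n" w] that by (simp add: words_def rotate_def)
    show "finite (words X (p ^ n))" using fin by simp
  qed (use inv in \<open>auto simp: words_def\<close>)
  also have "{w \<in> words X (p ^ n). rotate1 w = w} = replicate (p ^ n) ` X"
  proof (intro equalityI subsetI)
    fix w assume w: "w \<in> {w \<in> words X (p ^ n). rotate1 w = w}"
    then have "w = replicate (p ^ n) (hd w)"
      using rotate1_fixed_replicate[of w] by (simp add: words_def)
    moreover have "hd w \<in> X"
      using w pos by (auto simp: words_def intro!: subsetD[OF _ hd_in_set])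
    ultimately show "w \<in> replicate (p ^ n) ` X" by blast
  next
    fix w assume "w \<in> replicate (p ^ n) ` X"
    then show "w \<in> {w \<in> words X (p ^ n). rotate1 w = w}"
      using pos by (auto simp: words_def rotate1_replicate)
  qed
  also have "sum f (replicate (p ^ n) ` X) = (\<Sum>x\<in>X. f (replicate (p ^ n) x))"
    using pos by (subst sum.reindex) (auto simp: inj_on_def replicate_eq_replicate)
  finally show ?thesis .
qed

section \<open>Closed walks and traces of matrix powers\<close>

text \<open>The list holds the inner vertices of a walk from \<open>u\<close> to \<open>v\<close>.
  With \<open>n\<close> inner vertices there are \<open>n + 1\<close> steps, so summing over all
  such lists gives an entry of the power of \<open>M\<close> with exponent
  \<open>n + 1\<close>.\<close>

fun walk_weight :: "('a \<Rightarrow> 'a \<Rightarrow> 'f::comm_ring_1) \<Rightarrow> 'a \<Rightarrow> 'a list \<Rightarrow> 'a \<Rightarrow> 'f" where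
  "walk_weight M u [] v = M u v"
| "walk_weight M u (y # ys) v = M u y * walk_weight M y ys v"

lemma walk_weight_snoc:
  "walk_weight M u (ys @ [z]) v = walk_weight M u ys z * M z v"
  by (induction ys arbitrary: u) (simp_all add: mult.assoc)

lemma walk_weight_replicate:
  "walk_weight M u (replicate n u) u = M u u ^ Suc n"
  by (induction n) simp_all

text \<open>In matrix terms, the trace of the \<open>p\<^sup>n\<close>-th power of \<open>M\<close> is the \<open>p\<^sup>n\<close>-th power of its trace.\<close>

lemma sum_closed_walks:
  fixes M :: "'a \<Rightarrow> 'a \<Rightarrow> 'f::comm_ring_1"
  assumes p: "prime p" and char: "CHAR('f) = p" and fin: "finite X"
    and q: "p ^ n = Suc m"
  shows "(\<Sum>u\<in>X. \<Sum>ys\<in>words X m. walk_weight M u ys u) = (\<Sum>u\<in>X. M u u) ^ (p ^ n)"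
proof -
  \<comment> \<open>The word \<open>w\<close> encodes the closed walk through its letters, based at
    the first one; rotation only moves the base point.\<close>
  define f where "f w = walk_weight M (hd w) (tl w) (hd w)" for w
  have "(\<Sum>u\<in>X. \<Sum>ys\<in>words X m. walk_weight M u ys u) = (\<Sum>w\<in>words X (p ^ n). f w)"
    unfolding q sum_words_Suc by (simp add: f_def)
  also have "\<dots> = (\<Sum>u\<in>X. f (replicate (p ^ n) u))"
  proof (rule sum_words_rotation_invariant[OF p _ fin])
    show "of_nat p = (0::'f)" using char by auto
    fix w assume "w \<in> words X (p ^ n)"
    show "f (rotate1 w) = f w"
    proof (cases w rule: remdups_adj.cases)
      case (3 u y ys)
      then show ?thesis by (simp add: f_def walk_weight_snoc mult.commute)
    qed (simp_all add: f_def)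
  qed
  also have "\<dots> = (\<Sum>u\<in>X. M u u ^ (p ^ n))"
    unfolding q f_def by (simp add: walk_weight_replicate)
  also have "\<dots> = (\<Sum>u\<in>X. M u u) ^ (p ^ n)"
    using p char by (simp add: freshmans_dream_sum')
  finally show ?thesis .
qed

section \<open>Ideals in finite-dimensional commutative algebras\<close>

text \<open>Multiplication and unit are parameters, so that the same powers serve the abstract
  algebra and the group algebra.\<close>

primrec mult_pow :: "('v \<Rightarrow> 'v \<Rightarrow> 'v) \<Rightarrow> 'v \<Rightarrow> 'v \<Rightarrow> nat \<Rightarrow> 'v" where
  "mult_pow m u a 0 = u"
| "mult_pow m u a (Suc n) = m a (mult_pow m u a n)"

context vector_space
begin

text \<open>A vector of \<open>T\<close> outside \<open>S\<close> would enlarge a basis of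
  \<open>S\<close> to an independent set in \<open>T\<close> with \<open>dim S + 1\<close> elements;
  the finite set \<open>B\<close> guarantees finite bases.\<close>

lemma subspace_eq_of_dim_le:
  assumes S: "subspace S" and T: "subspace T" and sub: "S \<subseteq> T"
    and fin: "finite B" "T \<subseteq> span B" and le: "dim T \<le> dim S"
  shows "S = T"
proof (rule ccontr)
  assume "S \<noteq> T"
  then obtain t where t: "t \<in> T" "t \<notin> S" using sub by blast
  obtain C where C: "C \<subseteq> S" "independent C" "S \<subseteq> span C" "card C = dim S"
    using basis_exists .
  obtain D where D: "D \<subseteq> T" "independent D" "T \<subseteq> span D" "card D = dim T"
    using basis_exists .
  have fD: "finite D"
    using independent_span_bound[OF fin(1) D(2)] D(1) fin(2) by blast
  have "span C \<subseteq> S" using C(1) S by (rule span_minimal)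
  then have tC: "t \<notin> span C" using t by blast
  then have "independent (insert t C)" using C(2) by (rule independent_insertI)
  moreover have "insert t C \<subseteq> span D" using t C(1) sub D(3) by blast
  ultimately have "finite (insert t C) \<and> card (insert t C) \<le> card D"
    by (rule independent_span_bound[OF fD])
  moreover have "t \<notin> C" using tC span_base by blast
  ultimately show False using le C(4) D(4) by auto
qed

end

text \<open>\<open>Z\<close> is going to be the centre of a group algebra inside the space of all
  functions on the group type. Associativity and left linearity hold for all functions, whereas
  commutativity and the unit law are restricted to \<open>Z\<close>.\<close>

locale comm_algebra = vector_space scale
  for scale :: "'f::field \<Rightarrow> 'v::ab_group_add \<Rightarrow> 'v" +
  fixes m :: "'v \<Rightarrow> 'v \<Rightarrow> 'v" (infixl "\<star>" 70) and u :: 'v and Z :: "'v set"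
  assumes m_assoc: "(a \<star> b) \<star> c = a \<star> (b \<star> c)"
    and m_add_left: "(a + b) \<star> c = a \<star> c + b \<star> c"
    and m_scale_left: "scale k a \<star> b = scale k (a \<star> b)"
    and m_comm: "a \<in> Z \<Longrightarrow> b \<in> Z \<Longrightarrow> a \<star> b = b \<star> a"
    and Z_mult: "a \<in> Z \<Longrightarrow> b \<in> Z \<Longrightarrow> a \<star> b \<in> Z"
    and Z_unit: "u \<in> Z" and unit_left: "a \<in> Z \<Longrightarrow> u \<star> a = a"
    and Z_subspace: "subspace Z"
    and Z_fin: "\<exists>B. finite B \<and> Z \<subseteq> span B"
    and alg_closed: "alg_closed TYPE('f)"
begin

abbreviation pow :: "'v \<Rightarrow> nat \<Rightarrow> 'v" where
  "pow \<equiv> mult_pow m u"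

definition nilp :: "'v \<Rightarrow> bool" where
  "nilp a \<longleftrightarrow> (\<exists>n. pow a n = 0)"

definition idem :: "'v \<Rightarrow> bool" where
  "idem e \<longleftrightarrow> e \<in> Z \<and> e \<star> e = e"

definition prim :: "'v \<Rightarrow> bool" where
  "prim e \<longleftrightarrow> idem e \<and> e \<noteq> 0 \<and>
     \<not> (\<exists>e1 e2. idem e1 \<and> idem e2 \<and> e1 \<noteq> 0 \<and> e2 \<noteq> 0 \<and> e1 \<star> e2 = 0 \<and> e = e1 + e2)"

lemma Z_closed:
  "0 \<in> Z" "a \<in> Z \<Longrightarrow> b \<in> Z \<Longrightarrow> a + b \<in> Z" "a \<in> Z \<Longrightarrow> b \<in> Z \<Longrightarrow> a - b \<in> Z"
  "a \<in> Z \<Longrightarrow> scale k a \<in> Z"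
  using Z_subspace by (auto intro: subspace_0 subspace_add subspace_diff subspace_scale)

lemma Z_sum: "(\<And>i. i \<in> A \<Longrightarrow> f i \<in> Z) \<Longrightarrow> sum f A \<in> Z"
  using Z_subspace by (rule subspace_sum)

lemmas Z_intros = Z_closed Z_mult Z_unit Z_sum

lemma m_zero_left [simp]: "0 \<star> a = 0"
  using m_add_left[of 0 0 a] by simp

lemma m_diff_left: "(a - b) \<star> c = a \<star> c - b \<star> c"
  using m_add_left[of "a - b" b c] by (simp add: algebra_simps)

lemma m_sum_left: "sum f A \<star> c = (\<Sum>i\<in>A. f i \<star> c)"
  by (induction A rule: infinite_finite_induct) (simp_all add: m_add_left)

lemma m_add_right: "a \<in> Z \<Longrightarrow> b \<in> Z \<Longrightarrow> c \<in> Z \<Longrightarrow> c \<star> (a + b) = c \<star> a + c \<star> b"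
  using m_add_left[of a b c] by (simp add: m_comm Z_intros)

lemma m_diff_right: "a \<in> Z \<Longrightarrow> b \<in> Z \<Longrightarrow> c \<in> Z \<Longrightarrow> c \<star> (a - b) = c \<star> a - c \<star> b"
  using m_diff_left[of a b c] by (simp add: m_comm Z_intros)

lemma m_scale_right: "a \<in> Z \<Longrightarrow> c \<in> Z \<Longrightarrow> c \<star> scale k a = scale k (c \<star> a)"
  using m_scale_left[of k a c] by (simp add: m_comm Z_intros)

lemma m_zero_right [simp]: "c \<in> Z \<Longrightarrow> c \<star> 0 = 0"
  using m_comm[of c 0] by (simp add: Z_intros)

lemma unit_right: "a \<in> Z \<Longrightarrow> a \<star> u = a"
  using m_comm[of a u] by (simp add: Z_intros unit_left)

lemma m_left_comm: "a \<in> Z \<Longrightarrow> b \<in> Z \<Longrightarrow> a \<star> (b \<star> c) = b \<star> (a \<star> c)"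
  by (metis m_assoc m_comm)

lemma pow_Z [simp]: "a \<in> Z \<Longrightarrow> pow a n \<in> Z"
  by (induction n) (simp_all add: Z_intros)

lemma pow_add: "a \<in> Z \<Longrightarrow> pow a (n + k) = pow a n \<star> pow a k"
  by (induction n) (simp_all add: unit_left m_assoc)

lemma subspace_principal: "a \<in> Z \<Longrightarrow> subspace ((\<star>) a ` Z)"
proof (rule subspaceI)
  assume a: "a \<in> Z"
  show "0 \<in> (\<star>) a ` Z" using a Z_intros(1) by (intro image_eqI[of _ _ 0]) auto
  show "x + y \<in> (\<star>) a ` Z" if "x \<in> (\<star>) a ` Z" "y \<in> (\<star>) a ` Z" for x y
    using that a by (auto simp: m_add_right[symmetric] intro!: imageI Z_intros)
  show "scale c x \<in> (\<star>) a ` Z" if "x \<in> (\<star>) a ` Z" for x c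
    using that a by (auto simp: m_scale_right[symmetric] intro!: imageI Z_intros)
qed

lemma principal_subset: "a \<in> Z \<Longrightarrow> (\<star>) a ` Z \<subseteq> Z"
  by (auto intro: Z_intros)

text \<open>The descending chain of the ideals generated by \<open>w\<^sup>n\<close> becomes stationary.\<close>

lemma nilp_or_idem:
  assumes w: "w \<in> Z" and nn: "\<not> nilp w"
  obtains z where "z \<in> Z" "idem (w \<star> z)" "w \<star> z \<noteq> 0"
proof -
  \<comment> \<open>The exponent \<open>Suc n\<close> always leaves a factor \<open>w\<close>, so
    that the idempotent found below is a multiple of \<open>w\<close>.\<close>
  define U where "U n = (\<star>) (pow w (Suc n)) ` Z" for n
  define n where "n = (ARG_MIN (\<lambda>n. dim (U n)) n. True)"
  have min: "dim (U n) \<le> dim (U k)" for k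
    unfolding n_def by (rule arg_min_nat_le) simp
  \<comment> \<open>The ideal \<open>U (Suc (n + n))\<close> belongs to the exponent
    \<open>2 * n + 2\<close>, so it is generated by the square of \<open>a\<close>. By minimality it
    equals \<open>U n\<close>, and \<open>a\<close> becomes a multiple of its own square.\<close>
  define a where "a = pow w (Suc n)"
  have a: "a \<in> Z" unfolding a_def using w by (rule pow_Z)
  have Uk: "U (Suc (n + n)) = (\<star>) (a \<star> a) ` Z"
    unfolding U_def a_def using pow_add[OF w, of "Suc n" "Suc n"] by simp
  obtain B where B: "finite B" "Z \<subseteq> span B" using Z_fin by blast
  have "U (Suc (n + n)) = U n"
  proof (rule subspace_eq_of_dim_le[OF _ _ _ B(1) _ min])
    show "subspace (U n)" "subspace (U (Suc (n + n)))"
      unfolding U_def by (rule subspace_principal[OF pow_Z[OF w]])+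
    show "U n \<subseteq> span B"
      using principal_subset[OF pow_Z[OF w]] B(2) unfolding U_def by blast
    show "U (Suc (n + n)) \<subseteq> U n"
    proof -
      have "U n = (\<star>) a ` Z" by (simp only: U_def a_def)
      then show ?thesis unfolding Uk using a by (auto simp: m_assoc intro!: imageI Z_intros)
    qed
  qed
  moreover have "a \<in> U n"
    unfolding U_def a_def[symmetric] using a
    by (intro image_eqI[of _ _ u]) (simp_all add: unit_right Z_unit)
  ultimately obtain z where z: "z \<in> Z" "a = a \<star> a \<star> z"
    unfolding Uk by blast
  \<comment> \<open>Since \<open>a = a \<star> a \<star> z\<close>, the element \<open>f\<close> is
    idempotent and fixes \<open>a\<close>; hence it is nonzero.\<close>
  define f where "f = a \<star> z"
  have fZ: "f \<in> Z" using a z by (simp add: f_def Z_mult)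
  have af: "a = a \<star> f" using z by (simp add: f_def m_assoc)
  have "f \<star> f = (a \<star> f) \<star> z" using a z fZ
    by (metis f_def m_assoc m_comm)
  then have ff: "f \<star> f = f" using af by (simp add: f_def[symmetric])
  have "f \<noteq> 0"
  proof
    assume "f = 0"
    then have "a = 0" using af a by simp
    then show False using nn unfolding nilp_def a_def by blast
  qed
  moreover have "f = w \<star> (pow w n \<star> z)" by (simp add: f_def a_def m_assoc)
  ultimately show ?thesis
    using that[of "pow w n \<star> z"] ff fZ w z by (simp add: idem_def Z_mult)
qed

section \<open>Primitive idempotents\<close>

text \<open>The elements \<open>e \<star> f\<close> and \<open>e - e \<star> f\<close> are
  orthogonal idempotents with sum \<open>e\<close>, so primitivity makes one of them vanish.\<close>

lemma prim_idem_cases: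
  assumes e: "prim e" and f: "idem f"
  shows "e \<star> f = e \<or> e \<star> f = 0"
proof (rule ccontr)
  assume *: "\<not> ?thesis"
  have eZ: "e \<in> Z" "e \<star> e = e" and fZ: "f \<in> Z" "f \<star> f = f"
    using e f by (auto simp: prim_def idem_def)
  have ef: "e \<star> f \<in> Z" "e - e \<star> f \<in> Z" using eZ fZ by (auto intro: Z_intros)
  have ee: "e \<star> (e \<star> x) = e \<star> x" for x by (metis eZ(2) m_assoc)
  have ff: "f \<star> (f \<star> x) = f \<star> x" for x by (metis fZ(2) m_assoc)
  have fe: "f \<star> (e \<star> x) = e \<star> (f \<star> x)" for x using eZ fZ by (simp add: m_left_comm)
  have efe: "f \<star> e = e \<star> f" using eZ fZ by (simp add: m_comm)
  have "idem (e \<star> f)"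
    using ef by (simp add: idem_def m_assoc ee ff fe fZ)
  moreover have "idem (e - e \<star> f)"
    using ef eZ fZ by (simp add: idem_def m_diff_left m_diff_right m_assoc ee ff fe efe)
  moreover have "(e \<star> f) \<star> (e - e \<star> f) = 0"
    using ef eZ fZ by (simp add: m_diff_left m_diff_right m_assoc ee ff fe efe)
  moreover have "e = e \<star> f + (e - e \<star> f)" by simp
  ultimately show False
    using e * unfolding prim_def by (metis right_minus_eq)
qed

lemma prim_orthogonal:
  assumes "prim e" "prim f" "e \<noteq> f"
  shows "e \<star> f = 0"
proof -
  have "e \<star> f = f \<star> e" using assms by (auto simp: prim_def idem_def intro: m_comm)
  moreover have "e \<star> f = e \<or> e \<star> f = 0" "f \<star> e = f \<or> f \<star> e = 0"
    using prim_idem_cases[OF assms(1), of f] prim_idem_cases[OF assms(2), of e] assms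
    unfolding prim_def by blast+
  ultimately show ?thesis using assms by metis
qed

text \<open>Induction on the dimension of the ideal generated by \<open>f\<close>. If
  \<open>f\<close> splits as \<open>e1 + e2\<close>, the ideal of \<open>e1\<close> is strictly
  smaller: it cannot contain \<open>e2\<close>, which is nonzero and annihilated by
  \<open>e1\<close>.\<close>

lemma prim_below_idem:
  assumes "idem f" "f \<noteq> 0"
  obtains e where "prim e" "e \<star> f = e"
  using assms
proof (induction "dim ((\<star>) f ` Z)" arbitrary: f thesis rule: less_induct)
  case less
  have f: "f \<in> Z" "f \<star> f = f" using less.prems by (auto simp: idem_def)
  show ?case
  proof (cases "prim f")
    case True
    then show ?thesis using less.prems(1) f by blast
  next
    case False
    then obtain e1 e2 where e: "idem e1" "idem e2" "e1 \<noteq> 0" "e2 \<noteq> 0" "e1 \<star> e2 = 0" "f = e1 + e2"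
      using less.prems unfolding prim_def by blast
    have eZ: "e1 \<in> Z" "e2 \<in> Z" "e1 \<star> e1 = e1" "e2 \<star> e2 = e2" using e by (auto simp: idem_def)
    have e1f: "e1 \<star> f = e1" "f \<star> e1 = e1" and e2f: "f \<star> e2 = e2"
      using e eZ m_comm[of e1 e2] by (auto simp: m_add_right m_add_left)
    have sub: "(\<star>) e1 ` Z \<subseteq> (\<star>) f ` Z"
    proof safe
      fix z assume "z \<in> Z"
      then show "e1 \<star> z \<in> (\<star>) f ` Z"
        using e1f eZ by (intro image_eqI[of _ _ "e1 \<star> z"]) (auto simp: m_assoc[symmetric] Z_intros)
    qed
    have "e2 \<notin> (\<star>) e1 ` Z"
    proof
      assume "e2 \<in> (\<star>) e1 ` Z"
      then obtain z where z: "z \<in> Z" "e2 = e1 \<star> z" by blast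
      have "e2 = e2 \<star> (e1 \<star> z)" using z eZ by simp
      also have "\<dots> = (e1 \<star> e2) \<star> z" using eZ z by (metis m_assoc m_comm)
      finally show False using e by simp
    qed
    moreover have "e2 \<in> (\<star>) f ` Z" using e2f eZ by (intro image_eqI[of _ _ e2]) auto
    ultimately have ne: "(\<star>) e1 ` Z \<noteq> (\<star>) f ` Z" by blast
    obtain B where B: "finite B" "Z \<subseteq> span B" using Z_fin by blast
    have "\<not> dim ((\<star>) f ` Z) \<le> dim ((\<star>) e1 ` Z)"
      using subspace_eq_of_dim_le[OF subspace_principal subspace_principal sub B(1)]
        ne eZ(1) f(1) principal_subset[OF f(1)] B(2) by blast
    then obtain e' where e': "prim e'" "e' \<star> e1 = e'"
      using less.hyps[of e1] e by (metis not_le)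
    have "e' \<star> f = e' \<star> (e1 \<star> f)" using e' by (metis m_assoc)
    then have "e' \<star> f = e'" using e1f e' by simp
    then show ?thesis using less.prems(1) e' by blast
  qed
qed

section \<open>Eigenvectors over an algebraically closed field\<close>

text \<open>This is \<open>q(w) v\<close>. Keeping \<open>v\<close> as a factor confines all values
  to the ideal generated by \<open>v\<close>.\<close>

definition poly_eval :: "'v \<Rightarrow> 'v \<Rightarrow> 'f poly \<Rightarrow> 'v" where
  "poly_eval w v q = (\<Sum>i\<le>degree q. scale (coeff q i) (pow w i \<star> v))"

lemma poly_eval_bound:
  assumes "degree q \<le> N"
  shows "poly_eval w v q = (\<Sum>i\<le>N. scale (coeff q i) (pow w i \<star> v))"
  unfolding poly_eval_def
  by (rule sum.mono_neutral_left) (use assms in \<open>auto simp: coeff_eq_0\<close>)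

lemma poly_eval_Z: "w \<in> Z \<Longrightarrow> v \<in> Z \<Longrightarrow> poly_eval w v q \<in> Z"
  unfolding poly_eval_def by (intro Z_intros pow_Z)

text \<open>Multiplication by \<open>X - c\<close> acts as \<open>w - c\<close>; this turns roots of
  an annihilating polynomial into eigenvalues.\<close>

lemma poly_eval_linear_factor:
  assumes w: "w \<in> Z" and v: "v \<in> Z"
  shows "poly_eval w v ([:- c, 1:] * q) = w \<star> poly_eval w v q - scale c (poly_eval w v q)"
proof -
  define N where "N = Suc (degree q)"
  have eq: "[:- c, 1:] * q = pCons 0 q - smult c q" by simp
  have d: "degree ([:- c, 1:] * q) \<le> N"
    unfolding N_def by (metis degree_mult_le degree_pCons_eq_if One_nat_def add.commute plus_1_eq_Suc
        one_neq_zero pCons_eq_0_iff degree_0)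
  have wsum: "w \<star> poly_eval w v q = (\<Sum>i\<le>degree q. scale (coeff q i) (pow w (Suc i) \<star> v))"
  proof -
    have "w \<star> poly_eval w v q = poly_eval w v q \<star> w"
      using w v by (simp add: m_comm poly_eval_Z)
    also have "\<dots> = (\<Sum>i\<le>degree q. scale (coeff q i) (pow w (Suc i) \<star> v))"
      unfolding poly_eval_def m_sum_left
    proof (rule sum.cong)
      fix i
      have "(pow w i \<star> v) \<star> w = pow w (Suc i) \<star> v"
        using w v m_comm[of "pow w i \<star> v" w] by (simp add: m_assoc Z_mult)
      then show "scale (coeff q i) (pow w i \<star> v) \<star> w = scale (coeff q i) (pow w (Suc i) \<star> v)"
        by (simp add: m_scale_left)
    qed simp
    finally show ?thesis .
  qed
  have "poly_eval w v ([:- c, 1:] * q)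
      = (\<Sum>i\<le>N. scale (coeff (pCons 0 q) i) (pow w i \<star> v)) - (\<Sum>i\<le>N. scale (c * coeff q i) (pow w i \<star> v))"
    unfolding poly_eval_bound[OF d] unfolding eq coeff_diff coeff_smult
    by (simp add: scale_left_diff_distrib sum_subtractf)
  also have "(\<Sum>i\<le>N. scale (coeff (pCons 0 q) i) (pow w i \<star> v)) = w \<star> poly_eval w v q"
    unfolding wsum N_def by (subst sum.atMost_Suc_shift) simp
  also have "(\<Sum>i\<le>N. scale (c * coeff q i) (pow w i \<star> v)) = scale c (poly_eval w v q)"
    by (subst poly_eval_bound[of q N]) (simp_all add: N_def scale_sum_right scale_right_distrib)
  finally show ?thesis .
qed

text \<open>Write the annihilating polynomial as \<open>(X - c) r\<close>. Either
  \<open>r(w) v\<close> is nonzero, and then it is an eigenvector for \<open>c\<close>, or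
  \<open>r\<close> annihilates \<open>v\<close> and has smaller degree.\<close>

lemma eigenvector_of_poly:
  assumes w: "w \<in> Z" and v: "v \<in> Z" "v \<noteq> 0" and q: "q \<noteq> 0" "poly_eval w v q = 0"
  shows "\<exists>c r. poly_eval w v r \<noteq> 0 \<and> w \<star> poly_eval w v r = scale c (poly_eval w v r)"
  using q
proof (induction "degree q" arbitrary: q)
  case 0
  then obtain k where "q = [:k:]" "k \<noteq> 0" by (metis degree_eq_zeroE pCons_0_0)
  then have "poly_eval w v q = scale k v" by (simp add: poly_eval_def v unit_left)
  then show ?case using 0 v \<open>k \<noteq> 0\<close> by simp
next
  case (Suc d)
  then obtain c where "poly q c = 0"
    using alg_closed unfolding alg_closed_def by (metis zero_less_Suc)
  then obtain r where r: "q = [:- c, 1:] * r" by (metis dvdE poly_eq_0_iff_dvd)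
  have "r \<noteq> 0" using r Suc.prems by auto
  then have "degree q = Suc (degree r)"
    unfolding r by (subst degree_mult_eq) auto
  have "w \<star> poly_eval w v r = scale c (poly_eval w v r)"
    using poly_eval_linear_factor[OF w v(1), of c r] Suc.prems r by simp
  then show ?case
    using Suc.hyps(1)[of r] Suc.hyps(2) \<open>r \<noteq> 0\<close> \<open>degree q = _\<close> by (metis nat.inject)
qed

text \<open>The \<open>card B + 1\<close> vectors \<open>w^i v\<close> with
  \<open>i \<le> card B\<close> lie in the span of \<open>B\<close>; a linear relation among them is
  an annihilating polynomial.\<close>

lemma eigenvector_exists:
  assumes w: "w \<in> Z" and v: "v \<in> Z" "v \<noteq> 0"
  shows "\<exists>c r. poly_eval w v r \<noteq> 0 \<and> w \<star> poly_eval w v r = scale c (poly_eval w v r)"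
proof -
  obtain B where B: "finite B" "Z \<subseteq> span B" using Z_fin by blast
  define f where "f i = pow w i \<star> v" for i
  define N where "N = card B"
  have fZ: "f i \<in> Z" for i using w v by (simp add: f_def Z_mult)
  show ?thesis
  proof (cases "inj_on f {..N}")
    case False
    then obtain i j where ij: "i \<noteq> j" "f i = f j" by (auto simp: inj_on_def)
    \<comment> \<open>A repetition among the vectors is invisible in their set, so it is treated
      separately, with the annihilating polynomial \<open>X^i - X^j\<close>.\<close>
    define q :: "'f poly" where "q = monom 1 i - monom 1 j"
    have "coeff q i = 1" using ij by (simp add: q_def)
    then have "q \<noteq> 0" by auto
    moreover have "poly_eval w v q = 0"
    proof -
      have "poly_eval w v q = (\<Sum>k\<le>max (degree q) (max i j). scale (coeff q k) (f k))"
        unfolding f_def by (rule poly_eval_bound) simp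
      also have "\<dots> = (\<Sum>k\<le>max (degree q) (max i j). (if k = i then f k else 0) - (if k = j then f k else 0))"
        by (rule sum.cong) (auto simp: q_def)
      also have "\<dots> = f i - f j"
        unfolding sum_subtractf by (subst (1 2) sum.delta) auto
      finally show ?thesis using ij by simp
    qed
    ultimately show ?thesis using eigenvector_of_poly[OF w v] by blast
  next
    case True
    have "dependent (f ` {..N})"
    proof (rule ccontr)
      assume "independent (f ` {..N})"
      then have "card (f ` {..N}) \<le> card B"
        using independent_span_bound[OF B(1)] fZ B(2) by blast
      then show False using card_image[OF True] unfolding N_def by simp
    qed
    then obtain g where g: "(\<Sum>x\<in>f ` {..N}. scale (g x) x) = 0" "\<exists>x\<in>f ` {..N}. g x \<noteq> 0"
      by (subst (asm) dependent_finite) auto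
    define q where "q = (\<Sum>i\<le>N. monom (g (f i)) i)"
    have cq: "coeff q k = (if k \<le> N then g (f k) else 0)" for k
      by (simp add: q_def coeff_sum)
    have "degree q \<le> N" by (rule degree_le) (simp add: cq)
    then have "poly_eval w v q = (\<Sum>i\<le>N. scale (g (f i)) (f i))"
      by (simp add: poly_eval_bound[of q N] cq f_def)
    also have "\<dots> = 0" using g(1) by (simp add: sum.reindex[OF True])
    finally have "poly_eval w v q = 0" .
    moreover have "q \<noteq> 0" using g(2) cq by (metis (no_types, lifting) atMost_iff coeff_0 imageE)
    ultimately show ?thesis using eigenvector_of_poly[OF w v] by blast
  qed
qed

text \<open>The ideal generated by \<open>e\<close> is local with residue field \<open>F\<close>.
  Take an eigenvector \<open>y\<close> of \<open>w\<close> in it, with eigenvalue \<open>c\<close>.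
  If \<open>w - c e\<close> were not nilpotent, some multiple of it would be a nonzero idempotent,
  hence equal to \<open>e\<close>; but it annihilates \<open>y\<close>, and \<open>e\<close> fixes
  \<open>y\<close>.\<close>

lemma prim_scalar_plus_nilp:
  assumes e: "prim e" and w: "w \<in> Z" "w \<star> e = w"
  obtains c where "nilp (w - scale c e)"
proof -
  have eZ: "e \<in> Z" "e \<star> e = e" "e \<noteq> 0" using e by (auto simp: prim_def idem_def)
  obtain c r where cr: "poly_eval w e r \<noteq> 0" "w \<star> poly_eval w e r = scale c (poly_eval w e r)"
    using eigenvector_exists[OF w(1) eZ(1,3)] by blast
  define y where "y = poly_eval w e r"
  have yZ: "y \<in> Z" unfolding y_def using w(1) eZ(1) by (rule poly_eval_Z)
  have ye: "y \<star> e = y"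
    unfolding y_def poly_eval_def m_sum_left
    using eZ by (simp add: m_scale_left m_assoc)
  define x where "x = w - scale c e"
  have xZ: "x \<in> Z" using w eZ by (auto simp: x_def intro: Z_intros)
  have "e \<star> y = y" using ye eZ yZ by (simp add: m_comm)
  then have xy: "x \<star> y = 0" using cr(2) by (simp add: x_def m_diff_left m_scale_left y_def)
  have xe: "x \<star> e = x" using w eZ by (simp add: x_def m_diff_left m_scale_left)
  have "nilp x"
  proof (rule ccontr)
    assume "\<not> nilp x"
    then obtain z where z: "z \<in> Z" "idem (x \<star> z)" "x \<star> z \<noteq> 0"
      using nilp_or_idem[OF xZ] by blast
    have "e \<star> (x \<star> z) = x \<star> z"
      using xe eZ xZ by (metis m_assoc m_comm)
    then have "x \<star> z = e" using prim_idem_cases[OF e z(2)] z(3) by auto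
    then have "y = (x \<star> z) \<star> y" using \<open>e \<star> y = y\<close> by simp
    also have "\<dots> = (x \<star> y) \<star> z" using xZ yZ z by (simp add: m_assoc m_comm)
    finally show False using xy cr(1) by (simp add: y_def)
  qed
  then show ?thesis using that unfolding x_def by blast
qed

text \<open>The products \<open>e \<star> t\<close> with \<open>e\<close> primitive in
  \<open>I\<close> form a basis. Orthogonality gives independence; they span because each
  \<open>a\<close> in \<open>I\<close> is, up to nilpotent elements killed by \<open>t\<close>, a
  combination of these \<open>e\<close>.\<close>

theorem dim_ideal_times:
  assumes I_sub: "I \<subseteq> Z" and I_mult: "\<And>a z. a \<in> I \<Longrightarrow> z \<in> Z \<Longrightarrow> a \<star> z \<in> I"
    and t: "t \<in> Z" and nil: "\<And>z. z \<in> Z \<Longrightarrow> nilp z \<Longrightarrow> z \<star> t = 0"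
    and nz: "\<And>e. prim e \<Longrightarrow> e \<in> I \<Longrightarrow> e \<star> t \<noteq> 0"
  shows "dim ((\<lambda>a. a \<star> t) ` I) = card {e. prim e \<and> e \<in> I}"
proof -
  define E where "E = {e. prim e \<and> e \<in> I}"
  have E: "prim e" "e \<in> I" "e \<in> Z" "e \<star> e = e" if "e \<in> E" for e
    using that by (auto simp: E_def prim_def idem_def)
  have orth: "e \<star> f = (if e = f then e else 0)" if "e \<in> E" "f \<in> E" for e f
    using prim_orthogonal[of e f] E that by auto
  have inj: "inj_on (\<lambda>e. e \<star> t) E"
  proof (rule inj_onI)
    fix e f assume ef: "e \<in> E" "f \<in> E" "e \<star> t = f \<star> t"
    then have "e \<star> (e \<star> t) = (e \<star> f) \<star> t" by (simp add: m_assoc)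
    then show "e = f"
      using ef orth[of e f] E[of e] nz[of e] by (metis m_assoc m_zero_left)
  qed
  have indep: "independent ((\<lambda>e. e \<star> t) ` E)"
    unfolding independent_explicit_finite_subsets
  proof (intro allI impI ballI)
    fix S g v assume S: "S \<subseteq> (\<lambda>e. e \<star> t) ` E" "finite S" "(\<Sum>v\<in>S. scale (g v) v) = 0" "v \<in> S"
    then obtain E' where E': "E' \<subseteq> E" "S = (\<lambda>e. e \<star> t) ` E'" by (meson subset_imageE)
    have inj': "inj_on (\<lambda>e. e \<star> t) E'" using inj E' inj_on_subset by blast
    have finE': "finite E'" using S(2) E' inj' finite_image_iff by blast
    obtain f where f: "f \<in> E'" "v = f \<star> t" using S E' by blast
    have fE: "f \<in> E" using f E' by blast
    \<comment> \<open>Multiplying the relation by \<open>f\<close> leaves only the term belonging to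
      \<open>f\<close>.\<close>
    have "0 = (\<Sum>e\<in>E'. scale (g (e \<star> t)) (e \<star> t)) \<star> f"
      using S(3) unfolding E'(2) by (simp add: sum.reindex[OF inj'])
    also have "\<dots> = (\<Sum>e\<in>E'. if e = f then scale (g (f \<star> t)) (f \<star> t) else 0)"
      unfolding m_sum_left
    proof (rule sum.cong)
      fix e assume "e \<in> E'"
      then have eE: "e \<in> E" using E' by blast
      have "(e \<star> t) \<star> f = (e \<star> f) \<star> t" using E[OF fE] E[OF eE] t by (simp add: m_assoc m_comm)
      then show "scale (g (e \<star> t)) (e \<star> t) \<star> f = (if e = f then scale (g (f \<star> t)) (f \<star> t) else 0)"
        using orth[OF eE fE] by (simp add: m_scale_left)
    qed simp
    also have "\<dots> = scale (g v) (f \<star> t)" using f finE' by simp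
    finally show "g v = 0" using nz[of f] E[OF fE] by simp
  qed
  obtain B where B: "finite B" "Z \<subseteq> span B" using Z_fin by blast
  have "(\<lambda>e. e \<star> t) ` E \<subseteq> span B" using E(3) t B(2) by (auto intro: Z_mult)
  \<comment> \<open>Independence in a finite-dimensional space bounds the number of idempotents in
    \<open>E\<close>, which makes their sum \<open>s\<close> meaningful.\<close>
  then have "finite ((\<lambda>e. e \<star> t) ` E)" using independent_span_bound[OF B(1) indep] by blast
  then have finE: "finite E" using inj finite_image_iff by blast
  define s where "s = \<Sum>E"
  have sZ: "s \<in> Z" unfolding s_def using E(3) by (rule Z_sum)
  have se: "s \<star> e = e" if "e \<in> E" for e
  proof -
    have "s \<star> e = (\<Sum>f\<in>E. if f = e then e else 0)"
      unfolding s_def m_sum_left using orth that by (intro sum.cong) auto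
    then show ?thesis using that finE by simp
  qed
  have span: "(\<lambda>a. a \<star> t) ` I \<subseteq> span ((\<lambda>e. e \<star> t) ` E)"
  proof safe
    fix a assume a: "a \<in> I"
    have aZ: "a \<in> Z" using a I_sub by blast
    have "a \<star> (u - s) \<in> Z" using aZ sZ by (auto intro: Z_intros)
    \<comment> \<open>Otherwise some multiple of this element is a nonzero idempotent. A primitive
      \<open>e\<close> below it is a multiple of \<open>a\<close>, so it lies in \<open>E\<close>;
      but \<open>u - s\<close> annihilates \<open>E\<close>.\<close>
    moreover have "nilp (a \<star> (u - s))"
    proof (rule ccontr)
      assume "\<not> nilp (a \<star> (u - s))"
      then obtain z where z: "z \<in> Z" "idem (a \<star> (u - s) \<star> z)" "a \<star> (u - s) \<star> z \<noteq> 0"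
        using nilp_or_idem calculation by blast
      then obtain e where e: "prim e" "e \<star> (a \<star> (u - s) \<star> z) = e"
        using prim_below_idem by blast
      have eZ: "e \<in> Z" using e by (simp add: prim_def idem_def)
      have usZ: "u - s \<in> Z" using sZ by (auto intro: Z_intros)
      have "e = (a \<star> ((u - s) \<star> z)) \<star> e"
        using e eZ z aZ usZ by (metis m_assoc m_comm Z_mult)
      then have e1: "e = a \<star> ((u - s) \<star> z \<star> e)" by (simp add: m_assoc)
      then have "e \<in> I" using I_mult[OF a, of "(u - s) \<star> z \<star> e"] z eZ usZ by (simp add: Z_mult)
      then have "e \<in> E" using e by (simp add: E_def)
      then have "(u - s) \<star> e = 0" using se eZ by (simp add: m_diff_left unit_left)
      then have "(u - s) \<star> z \<star> e = 0"
        using z eZ usZ by (metis m_assoc m_comm m_zero_right)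
      then have "e = 0" using e1 aZ by simp
      then show False using e by (simp add: prim_def)
    qed
    ultimately have zero: "(a \<star> (u - s)) \<star> t = 0" by (rule nil)
    have ae: "(a \<star> e) \<star> t \<in> span ((\<lambda>e. e \<star> t) ` E)" if e: "e \<in> E" for e
    proof -
      have "(a \<star> e) \<star> e = a \<star> e" using E[OF e] by (simp add: m_assoc)
      then obtain c where c: "nilp (a \<star> e - scale c e)"
        using prim_scalar_plus_nilp[OF E(1)[OF e], of "a \<star> e"] aZ E(3)[OF e] by (metis Z_mult)
      have "(a \<star> e - scale c e) \<star> t = 0"
        using c aZ E(3)[OF e] by (intro nil Z_intros)
      then have "(a \<star> e) \<star> t = scale c (e \<star> t)" by (simp add: m_diff_left m_scale_left)
      then show ?thesis using e by (simp add: span_base span_scale)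
    qed
    have "a \<star> t = (a \<star> s) \<star> t"
      using zero aZ sZ by (simp add: m_diff_right m_diff_left unit_right Z_unit)
    also have "\<dots> = (\<Sum>e\<in>E. (a \<star> e) \<star> t)"
    proof -
      have "a \<star> s = s \<star> a" using aZ sZ by (rule m_comm)
      also have "\<dots> = (\<Sum>e\<in>E. a \<star> e)"
        unfolding s_def m_sum_left using aZ E(3) by (intro sum.cong m_comm) auto
      finally show ?thesis by (simp add: m_sum_left)
    qed
    also have "\<dots> \<in> span ((\<lambda>e. e \<star> t) ` E)" using ae by (rule span_sum)
    finally show "a \<star> t \<in> span ((\<lambda>e. e \<star> t) ` E)" .
  qed
  have "dim ((\<lambda>a. a \<star> t) ` I) = card E"
    by (rule dim_unique[OF _ span indep]) (use E(2) inj in \<open>auto simp: card_image\<close>)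
  then show ?thesis by (simp add: E_def)
qed

end

section \<open>The group algebra\<close>

locale finite_group = group G for G (structure) +
  assumes finite_carrier [simp]: "finite (carrier G)"
begin

abbreviation gm :: "('a \<Rightarrow> 'f::field) \<Rightarrow> ('a \<Rightarrow> 'f) \<Rightarrow> 'a \<Rightarrow> 'f" (infixl "\<star>" 70) where
  "a \<star> b \<equiv> ga_mult G a b"

definition ga_basis :: "'a \<Rightarrow> 'a \<Rightarrow> 'f::field" where
  "ga_basis g = (\<lambda>x. if x = g then 1 else 0)"

abbreviation ga_pow :: "('a \<Rightarrow> 'f::field) \<Rightarrow> nat \<Rightarrow> 'a \<Rightarrow> 'f" where
  "ga_pow \<equiv> mult_pow (ga_mult G) (ga_basis \<one>)"

text \<open>The relative trace from the trivial subgroup, summed over elements in place of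
  cosets.\<close>

definition ga_trace :: "('a \<Rightarrow> 'f::field) \<Rightarrow> 'a \<Rightarrow> 'f" where
  "ga_trace a = (\<lambda>h. \<Sum>x\<in>carrier G. ga_conj G x a h)"

definition class_fun :: "('a \<Rightarrow> 'f::field) \<Rightarrow> bool" where
  "class_fun z \<longleftrightarrow> z \<in> group_alg G \<and>
     (\<forall>x\<in>carrier G. \<forall>h\<in>carrier G. z (inv x \<otimes> h \<otimes> x) = z h)"

lemma group_alg_outside: "a \<in> group_alg G \<Longrightarrow> x \<notin> carrier G \<Longrightarrow> a x = 0"
  by (simp add: group_alg_def)

lemma group_alg_mult [simp]: "a \<star> b \<in> group_alg G"
  by (simp add: group_alg_def ga_mult_def)

lemma group_alg_basis [simp]: "g \<in> carrier G \<Longrightarrow> ga_basis g \<in> group_alg G"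
  by (auto simp: group_alg_def ga_basis_def)

lemma group_alg_pow [simp]: "ga_pow a n \<in> group_alg G"
  by (cases n) simp_all

lemma group_alg_trace [simp]: "ga_trace a \<in> group_alg G"
  by (simp add: group_alg_def ga_trace_def ga_conj_def)

lemma group_alg_eqI:
  assumes "a \<in> group_alg G" "b \<in> group_alg G" "\<And>x. x \<in> carrier G \<Longrightarrow> a x = b x"
  shows "a = b"
proof
  fix x
  show "a x = b x"
    using assms group_alg_outside[of a x] group_alg_outside[of b x] by (cases "x \<in> carrier G") auto
qed

lemma ga_mult_apply: "x \<in> carrier G \<Longrightarrow> (a \<star> b) x = (\<Sum>y\<in>carrier G. a y * b (inv y \<otimes> x))"
  by (simp add: ga_mult_def)

lemma sum_left_translate:
  assumes g: "g \<in> carrier G"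
  shows "(\<Sum>y\<in>carrier G. f (g \<otimes> y)) = (\<Sum>y\<in>carrier G. f y)"
  by (rule sum.reindex_bij_witness[of _ "\<lambda>y. inv g \<otimes> y" "\<lambda>y. g \<otimes> y"])
     (use g in \<open>auto simp: m_assoc[symmetric]\<close>)

lemma sum_right_translate:
  assumes g: "g \<in> carrier G"
  shows "(\<Sum>y\<in>carrier G. f (y \<otimes> g)) = (\<Sum>y\<in>carrier G. f y)"
  by (rule sum.reindex_bij_witness[of _ "\<lambda>y. y \<otimes> inv g" "\<lambda>y. y \<otimes> g"])
     (use g in \<open>auto simp: m_assoc\<close>)

lemma sum_inverse:
  "(\<Sum>y\<in>carrier G. f (inv y)) = (\<Sum>y\<in>carrier G. f y)"
  by (rule sum.reindex_bij_witness[of _ "\<lambda>y. inv y" "\<lambda>y. inv y"]) auto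

lemma sum_conjugate:
  assumes g: "g \<in> carrier G"
  shows "(\<Sum>y\<in>carrier G. f (inv g \<otimes> y \<otimes> g)) = (\<Sum>y\<in>carrier G. f y)"
proof -
  have "(\<Sum>y\<in>carrier G. f (inv g \<otimes> y \<otimes> g)) = (\<Sum>y\<in>carrier G. f (y \<otimes> g))"
    using sum_left_translate[of "inv g" "\<lambda>y. f (y \<otimes> g)"] g by simp
  then show ?thesis using sum_right_translate[OF g] by simp
qed

lemma ga_mult_assoc: "(a \<star> b) \<star> c = a \<star> (b \<star> c)"
proof (rule group_alg_eqI)
  fix x assume x: "x \<in> carrier G"
  have "((a \<star> b) \<star> c) x = (\<Sum>y\<in>carrier G. \<Sum>v\<in>carrier G. a v * (b (inv v \<otimes> y) * c (inv y \<otimes> x)))"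
    using x by (simp add: ga_mult_apply sum_distrib_right mult.assoc)
  also have "\<dots> = (\<Sum>v\<in>carrier G. \<Sum>y\<in>carrier G. a v * (b (inv v \<otimes> y) * c (inv y \<otimes> x)))"
    by (rule sum.swap)
  also have "\<dots> = (\<Sum>v\<in>carrier G. \<Sum>y\<in>carrier G. a v * (b y * c (inv y \<otimes> (inv v \<otimes> x))))"
  proof (rule sum.cong)
    fix v assume v: "v \<in> carrier G"
    have "(\<Sum>y\<in>carrier G. a v * (b (inv v \<otimes> y) * c (inv y \<otimes> x)))
        = (\<Sum>y\<in>carrier G. a v * (b (inv v \<otimes> (v \<otimes> y)) * c (inv (v \<otimes> y) \<otimes> x)))"
      using sum_left_translate[OF v, of "\<lambda>y. a v * (b (inv v \<otimes> y) * c (inv y \<otimes> x))"] by simp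
    also have "\<dots> = (\<Sum>y\<in>carrier G. a v * (b y * c (inv y \<otimes> (inv v \<otimes> x))))"
      using v x by (intro sum.cong) (simp_all add: inv_mult_group m_assoc, simp add: m_assoc[symmetric])
    finally show "(\<Sum>y\<in>carrier G. a v * (b (inv v \<otimes> y) * c (inv y \<otimes> x)))
        = (\<Sum>y\<in>carrier G. a v * (b y * c (inv y \<otimes> (inv v \<otimes> x))))" .
  qed simp
  also have "\<dots> = (a \<star> (b \<star> c)) x"
    using x by (simp add: ga_mult_apply sum_distrib_left)
  finally show "((a \<star> b) \<star> c) x = (a \<star> (b \<star> c)) x" .
qed simp_all

lemma ga_mult_add_left: "(a + b) \<star> c = a \<star> c + b \<star> c"
  by (auto simp: ga_mult_def fun_eq_iff sum.distrib algebra_simps)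

lemma ga_mult_scale_left: "(\<lambda>x. k * a x) \<star> b = (\<lambda>x. k * (a \<star> b) x)"
  by (auto simp: ga_mult_def fun_eq_iff sum_distrib_left mult.assoc)

lemma ga_mult_scale_right: "a \<star> (\<lambda>x. k * b x) = (\<lambda>x. k * (a \<star> b) x)"
  by (auto simp: ga_mult_def fun_eq_iff sum_distrib_left mult.left_commute)

lemma ga_mult_zero_left [simp]: "0 \<star> a = 0"
  by (auto simp: ga_mult_def fun_eq_iff)

lemma ga_mult_zero_right [simp]: "a \<star> 0 = 0"
  by (auto simp: ga_mult_def fun_eq_iff)

lemma ga_basis_mult:
  assumes "g \<in> carrier G" "x \<in> carrier G"
  shows "(ga_basis g \<star> a) x = a (inv g \<otimes> x)"
  using assms by (simp add: ga_mult_apply ga_basis_def if_distrib[of "\<lambda>k. k * _"] cong: if_cong)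

lemma ga_mult_basis:
  assumes g: "g \<in> carrier G" and x: "x \<in> carrier G"
  shows "(a \<star> ga_basis g) x = a (x \<otimes> inv g)"
proof -
  have "inv y \<otimes> x = g \<longleftrightarrow> y = x \<otimes> inv g" if y: "y \<in> carrier G" for y
    using g x y by (metis inv_closed inv_inv inv_solve_left' inv_solve_right m_closed)
  then have "(a \<star> ga_basis g) x = (\<Sum>y\<in>carrier G. if y = x \<otimes> inv g then a y else 0)"
    using x unfolding ga_mult_apply[OF x] by (intro sum.cong) (auto simp: ga_basis_def)
  then show ?thesis using g x by simp
qed

lemma ga_one_left: "a \<in> group_alg G \<Longrightarrow> ga_basis \<one> \<star> a = a"
  by (rule group_alg_eqI) (simp_all add: ga_basis_mult)

lemma ga_one_right: "a \<in> group_alg G \<Longrightarrow> a \<star> ga_basis \<one> = a"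
  by (rule group_alg_eqI) (simp_all add: ga_mult_basis)

section \<open>The centre and the trace map\<close>

text \<open>The coefficient of \<open>z \<star> a\<close> at \<open>x\<close> pairs
  \<open>a y\<close> with \<open>z (x \<otimes> inv y)\<close>; conjugation by \<open>y\<close>
  moves \<open>inv y\<close> to the other side of \<open>x\<close>.\<close>

lemma class_fun_commute:
  assumes z: "class_fun z"
  shows "z \<star> a = a \<star> z"
proof (rule group_alg_eqI)
  fix x assume x: "x \<in> carrier G"
  have "(z \<star> a) x = (\<Sum>y\<in>carrier G. z (x \<otimes> inv y) * a y)"
  proof -
    have "(z \<star> a) x = (\<Sum>y\<in>carrier G. z (x \<otimes> y) * a (inv (x \<otimes> y) \<otimes> x))"
      using sum_left_translate[OF x, of "\<lambda>y. z y * a (inv y \<otimes> x)"] x by (simp add: ga_mult_apply)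
    also have "\<dots> = (\<Sum>y\<in>carrier G. z (x \<otimes> inv y) * a (inv (x \<otimes> inv y) \<otimes> x))"
      using sum_inverse[of "\<lambda>y. z (x \<otimes> y) * a (inv (x \<otimes> y) \<otimes> x)"] by simp
    also have "\<dots> = (\<Sum>y\<in>carrier G. z (x \<otimes> inv y) * a y)"
      using x by (intro sum.cong) (simp_all add: inv_mult_group m_assoc)
    finally show ?thesis .
  qed
  also have "\<dots> = (\<Sum>y\<in>carrier G. a y * z (inv y \<otimes> x))"
  proof (rule sum.cong)
    fix y assume y: "y \<in> carrier G"
    have "z (x \<otimes> inv y) = z (inv y \<otimes> (x \<otimes> inv y) \<otimes> y)"
      using z x y by (simp add: class_fun_def)
    also have "inv y \<otimes> (x \<otimes> inv y) \<otimes> y = inv y \<otimes> x"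
      using x y by (simp add: m_assoc)
    finally show "z (x \<otimes> inv y) * a y = a y * z (inv y \<otimes> x)" by simp
  qed simp
  also have "\<dots> = (a \<star> z) x" using x by (simp add: ga_mult_apply)
  finally show "(z \<star> a) x = (a \<star> z) x" .
qed simp_all

text \<open>Commuting with the group element \<open>x\<close>, read off at the coefficient of
  \<open>h \<otimes> x\<close>, is invariance of \<open>z\<close> under conjugation by
  \<open>x\<close>.\<close>

lemma center_iff_class_fun: "z \<in> ga_center G \<longleftrightarrow> class_fun z"
proof
  assume z: "z \<in> ga_center G"
  then have zA: "z \<in> group_alg G" by (simp add: ga_center_def)
  have "z (inv x \<otimes> h \<otimes> x) = z h" if x: "x \<in> carrier G" and h: "h \<in> carrier G" for x h
  proof -
    have "z \<star> ga_basis x = ga_basis x \<star> z" using z x by (simp add: ga_center_def)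
    then have "(z \<star> ga_basis x) (h \<otimes> x) = (ga_basis x \<star> z) (h \<otimes> x)" by simp
    then show ?thesis using x h by (simp add: ga_basis_mult ga_mult_basis m_assoc)
  qed
  then show "class_fun z" using zA by (simp add: class_fun_def)
next
  assume "class_fun z"
  then show "z \<in> ga_center G"
    using class_fun_commute by (auto simp: ga_center_def class_fun_def)
qed

lemma center_commute: "z \<in> ga_center G \<Longrightarrow> z \<star> a = a \<star> z"
  by (simp add: center_iff_class_fun class_fun_commute)

lemma center_group_alg: "z \<in> ga_center G \<Longrightarrow> z \<in> group_alg G"
  by (simp add: ga_center_def)

lemma center_mult:
  assumes "a \<in> ga_center G" "b \<in> ga_center G"
  shows "a \<star> b \<in> ga_center G"
proof -
  have "(a \<star> b) \<star> c = c \<star> (a \<star> b)" for c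
  proof -
    have "(a \<star> b) \<star> c = a \<star> (c \<star> b)" by (simp only: ga_mult_assoc center_commute[OF assms(2), of c])
    also have "\<dots> = (c \<star> a) \<star> b" by (simp only: ga_mult_assoc[symmetric] center_commute[OF assms(1), of c])
    finally show ?thesis by (simp only: ga_mult_assoc)
  qed
  then show ?thesis by (simp add: ga_center_def)
qed

lemma trace_center: "ga_trace a \<in> ga_center G"
proof -
  have "ga_trace a (inv x \<otimes> h \<otimes> x) = ga_trace a h" if x: "x \<in> carrier G" and h: "h \<in> carrier G" for x h
  proof -
    have "ga_trace a (inv x \<otimes> h \<otimes> x) = (\<Sum>y\<in>carrier G. a (inv (x \<otimes> y) \<otimes> h \<otimes> (x \<otimes> y)))"
      unfolding ga_trace_def ga_conj_def using x h
      by (intro sum.cong) (simp_all add: inv_mult_group m_assoc)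
    also have "\<dots> = ga_trace a h"
      using sum_left_translate[OF x, of "\<lambda>y. a (inv y \<otimes> h \<otimes> y)"] h
      by (simp add: ga_trace_def ga_conj_def)
    finally show ?thesis .
  qed
  then show ?thesis by (simp add: center_iff_class_fun class_fun_def)
qed

text \<open>Conjugation is an algebra automorphism fixing \<open>z\<close>. Consequently the image
  of the trace is an ideal of the centre.\<close>

lemma trace_mult_center:
  assumes z: "z \<in> ga_center G"
  shows "ga_trace a \<star> z = ga_trace (a \<star> z)"
proof (rule group_alg_eqI)
  fix h assume h: "h \<in> carrier G"
  have zc: "z (inv x \<otimes> g \<otimes> x) = z g" if "x \<in> carrier G" "g \<in> carrier G" for x g
    using z that by (simp add: center_iff_class_fun class_fun_def)
  have "ga_trace (a \<star> z) h
      = (\<Sum>x\<in>carrier G. \<Sum>y\<in>carrier G. a y * z (inv y \<otimes> (inv x \<otimes> h \<otimes> x)))"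
    using h by (simp add: ga_trace_def ga_conj_def ga_mult_apply)
  also have "\<dots> = (\<Sum>x\<in>carrier G. \<Sum>y\<in>carrier G. a (inv x \<otimes> y \<otimes> x) * z (inv y \<otimes> h))"
  proof (rule sum.cong)
    fix x assume x: "x \<in> carrier G"
    have "(\<Sum>y\<in>carrier G. a y * z (inv y \<otimes> (inv x \<otimes> h \<otimes> x)))
        = (\<Sum>y\<in>carrier G. a (inv x \<otimes> y \<otimes> x) * z (inv (inv x \<otimes> y \<otimes> x) \<otimes> (inv x \<otimes> h \<otimes> x)))"
      using sum_conjugate[OF x, of "\<lambda>y. a y * z (inv y \<otimes> (inv x \<otimes> h \<otimes> x))"] by simp
    also have "\<dots> = (\<Sum>y\<in>carrier G. a (inv x \<otimes> y \<otimes> x) * z (inv y \<otimes> h))"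
    proof (rule sum.cong)
      fix y assume y: "y \<in> carrier G"
      have "x \<otimes> (inv x \<otimes> k) = k" if "k \<in> carrier G" for k
        using x that by (simp add: m_assoc[symmetric])
      then have "inv (inv x \<otimes> y \<otimes> x) \<otimes> (inv x \<otimes> h \<otimes> x) = inv x \<otimes> (inv y \<otimes> h) \<otimes> x"
        using x y h by (simp add: inv_mult_group m_assoc)
      then show "a (inv x \<otimes> y \<otimes> x) * z (inv (inv x \<otimes> y \<otimes> x) \<otimes> (inv x \<otimes> h \<otimes> x))
          = a (inv x \<otimes> y \<otimes> x) * z (inv y \<otimes> h)"
        using zc[of x "inv y \<otimes> h"] x y h by simp
    qed simp
    finally show "(\<Sum>y\<in>carrier G. a y * z (inv y \<otimes> (inv x \<otimes> h \<otimes> x)))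
        = (\<Sum>y\<in>carrier G. a (inv x \<otimes> y \<otimes> x) * z (inv y \<otimes> h))" .
  qed simp
  also have "\<dots> = (\<Sum>y\<in>carrier G. \<Sum>x\<in>carrier G. a (inv x \<otimes> y \<otimes> x) * z (inv y \<otimes> h))"
    by (rule sum.swap)
  also have "\<dots> = (ga_trace a \<star> z) h"
    using h by (simp add: ga_mult_apply ga_trace_def ga_conj_def sum_distrib_right)
  finally show "(ga_trace a \<star> z) h = ga_trace (a \<star> z) h" by simp
qed simp_all

lemma ga_pow_commute: "a \<in> group_alg G \<Longrightarrow> ga_pow a n \<star> a = a \<star> ga_pow a n"
  by (induction n) (simp_all add: ga_one_left ga_one_right ga_mult_assoc)

lemma ga_pow_mult_center:
  assumes a: "a \<in> group_alg G" and z: "z \<in> ga_center G"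
  shows "ga_pow (a \<star> z) n = ga_pow a n \<star> ga_pow z n"
proof (induction n)
  case 0
  show ?case by (simp add: ga_one_left)
next
  case (Suc n)
  have "ga_pow (a \<star> z) (Suc n) = a \<star> ((z \<star> ga_pow a n) \<star> ga_pow z n)"
    using Suc by (simp add: ga_mult_assoc)
  also have "z \<star> ga_pow a n = ga_pow a n \<star> z" using z by (rule center_commute)
  finally show ?case by (simp add: ga_mult_assoc)
qed

lemma ga_pow_zero_mono:
  assumes "ga_pow a n = 0" "n \<le> k"
  shows "ga_pow a k = 0"
  using assms(2,1) by (induction k rule: dec_induct) auto

lemma ga_pow_idem:
  assumes "e \<in> group_alg G" "e \<star> e = e" "n > 0"
  shows "ga_pow e n = e"
proof -
  have "ga_pow e (Suc k) = e" for k
    by (induction k) (use assms in \<open>auto simp: ga_one_right\<close>)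
  then show ?thesis using assms(3) by (metis Suc_pred)
qed

text \<open>Translating by \<open>inv g\<close> moves a nonzero coefficient at \<open>g\<close> to
  \<open>\<one>\<close>. An element can thus be shown to vanish by testing coefficients at
  \<open>\<one>\<close> of its multiples.\<close>

lemma ga_nondegenerate:
  assumes a: "a \<in> group_alg G" "a \<noteq> 0"
  obtains x where "x \<in> group_alg G" "(x \<star> a) \<one> \<noteq> 0"
proof -
  obtain g where g: "g \<in> carrier G" "a g \<noteq> 0"
    using a by (auto simp: group_alg_def fun_eq_iff)
  then have "(ga_basis (inv g) \<star> a) \<one> \<noteq> 0" by (simp add: ga_basis_mult)
  then show ?thesis using that g by (metis group_alg_basis inv_closed)
qed

section \<open>Coefficients of powers\<close>

lemma foldr_mult_closed: "set w \<subseteq> carrier G \<Longrightarrow> foldr (\<otimes>) w \<one> \<in> carrier G"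
  by (induction w) auto

lemma foldr_mult_snoc:
  "set w \<subseteq> carrier G \<Longrightarrow> g \<in> carrier G \<Longrightarrow> foldr (\<otimes>) (w @ [g]) \<one> = foldr (\<otimes>) w \<one> \<otimes> g"
  by (induction w) (auto simp: m_assoc foldr_mult_closed)

lemma foldr_mult_replicate: "g \<in> carrier G \<Longrightarrow> foldr (\<otimes>) (replicate n g) \<one> = g [^] n"
  by (induction n) (simp_all add: nat_pow_mult[symmetric] nat_pow_comm flip: nat_pow_Suc2)

text \<open>Expanding the power into words makes the rotation argument applicable.\<close>

lemma ga_pow_words:
  assumes "x \<in> carrier G"
  shows "ga_pow a n x =
    (\<Sum>w\<in>words (carrier G) n. if foldr (\<otimes>) w \<one> = x then prod_list (map a w) else 0)"
  using assms
proof (induction n arbitrary: x)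
  case 0
  then show ?case by (simp add: ga_basis_def)
next
  case (Suc n)
  have "ga_pow a (Suc n) x = (\<Sum>y\<in>carrier G. \<Sum>w\<in>words (carrier G) n.
      a y * (if foldr (\<otimes>) w \<one> = inv y \<otimes> x then prod_list (map a w) else 0))"
    using Suc by (simp add: ga_mult_apply sum_distrib_left)
  also have "\<dots> = (\<Sum>y\<in>carrier G. \<Sum>w\<in>words (carrier G) n.
      if foldr (\<otimes>) (y # w) \<one> = x then prod_list (map a (y # w)) else 0)"
  proof (intro sum.cong refl)
    fix y w assume y: "y \<in> carrier G" and w: "w \<in> words (carrier G) n"
    have "foldr (\<otimes>) w \<one> \<in> carrier G" using w by (simp add: words_def foldr_mult_closed)
    then have "foldr (\<otimes>) w \<one> = inv y \<otimes> x \<longleftrightarrow> foldr (\<otimes>) (y # w) \<one> = x"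
      using y Suc.prems inv_solve_left'[of "foldr (\<otimes>) w \<one>" y x] by auto
    then show "a y * (if foldr (\<otimes>) w \<one> = inv y \<otimes> x then prod_list (map a w) else 0)
        = (if foldr (\<otimes>) (y # w) \<one> = x then prod_list (map a (y # w)) else 0)" by simp
  qed
  finally show ?case by (simp add: sum_words_Suc)
qed

section \<open>The sum of the p-elements\<close>

lemma p_elements_iff:
  assumes "prime p"
  shows "x \<in> p_elements G p \<longleftrightarrow> x \<in> carrier G \<and> (\<exists>k. x [^] (p ^ k) = \<one>)"
proof
  assume "x \<in> p_elements G p"
  then obtain k where "x \<in> carrier G" "ord x = p ^ k" by (auto simp: p_elements_def)
  then show "x \<in> carrier G \<and> (\<exists>k. x [^] (p ^ k) = \<one>)" by (metis pow_ord_eq_1)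
next
  assume x: "x \<in> carrier G \<and> (\<exists>k. x [^] (p ^ k) = \<one>)"
  then obtain k where "ord x dvd p ^ k" by (auto simp: pow_eq_id)
  then obtain i where "ord x = p ^ i" using assms by (auto simp: divides_primepow_nat)
  then show "x \<in> p_elements G p" using x by (auto simp: p_elements_def)
qed

text \<open>An order \<open>p ^ k\<close> is at most \<open>card (carrier G)\<close>, and
  \<open>k < p ^ k\<close>, so the single exponent \<open>p ^ n\<close> detects all
  p-elements.\<close>

lemma p_elements_uniform:
  assumes p: "prime p" and n: "card (carrier G) \<le> n"
  shows "x \<in> p_elements G p \<longleftrightarrow> x \<in> carrier G \<and> x [^] (p ^ n) = \<one>"
proof
  assume "x \<in> p_elements G p"
  then obtain k where x: "x \<in> carrier G" "ord x = p ^ k" by (auto simp: p_elements_def)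
  have "p ^ k \<le> card (carrier G)"
    using ord_le_group_order[OF finite_carrier x(1)] x(2) by (simp add: Coset.order_def)
  moreover have "k < p ^ k" using p by (intro power_gt_expt) (simp add: prime_gt_Suc_0_nat)
  ultimately have "p ^ k dvd p ^ n" using n by (simp add: le_imp_power_dvd)
  then show "x \<in> carrier G \<and> x [^] (p ^ n) = \<one>" using x by (simp add: pow_eq_id)
qed (use p in \<open>auto simp: p_elements_iff\<close>)

abbreviation psum :: "nat \<Rightarrow> 'a \<Rightarrow> 'f::field" where
  "psum \<equiv> p_elem_sum G"

lemma psum_center:
  assumes p: "prime p"
  shows "psum p \<in> ga_center G"
proof -
  have "inv x \<otimes> h \<otimes> x \<in> p_elements G p \<longleftrightarrow> h \<in> p_elements G p"
    if x: "x \<in> carrier G" and h: "h \<in> carrier G" for x h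
  proof -
    have "(inv x \<otimes> h \<otimes> x) [^] k = inv x \<otimes> h [^] k \<otimes> x" for k :: nat
    proof (induction k)
      case (Suc k)
      have "x \<otimes> (inv x \<otimes> y) = y" if "y \<in> carrier G" for y
        using x that by (simp add: m_assoc[symmetric])
      then show ?case using Suc x h by (simp add: m_assoc)
    qed (use x in simp)
    moreover have "inv x \<otimes> y \<otimes> x = \<one> \<longleftrightarrow> y = \<one>" if "y \<in> carrier G" for y
      using x that by (metis inv_closed inv_inv inv_solve_right l_inv m_closed r_inv r_one l_one inv_solve_left')
    ultimately show ?thesis using x h p by (simp add: p_elements_iff)
  qed
  then show ?thesis
    by (auto simp: center_iff_class_fun class_fun_def p_elem_sum_def group_alg_def p_elements_def)
qed

text \<open>Rotating a word with trivial product keeps the product trivial, so modulo \<open>p\<close> only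
  constant words contribute to the coefficient of \<open>\<one>\<close> in a \<open>p\<^sup>n\<close>-th power.\<close>

lemma ga_pow_coeff_one:
  fixes a :: "'a \<Rightarrow> 'f::field"
  assumes p: "prime p" and char: "CHAR('f) = p" and n: "card (carrier G) \<le> n"
  shows "ga_pow a (p ^ n) \<one> = ((a \<star> psum p) \<one>) ^ (p ^ n)"
proof -
  define f where "f w = (if foldr (\<otimes>) w \<one> = \<one> then prod_list (map a w) else 0)" for w
  have pos: "p ^ n \<noteq> 0" using p by auto
  have "ga_pow a (p ^ n) \<one> = (\<Sum>w\<in>words (carrier G) (p ^ n). f w)"
    by (simp add: ga_pow_words f_def)
  also have "\<dots> = (\<Sum>x\<in>carrier G. f (replicate (p ^ n) x))"
  proof (rule sum_words_rotation_invariant[OF p])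
    show "of_nat p = (0::'f)" using char by auto
    fix w assume w: "w \<in> words (carrier G) (p ^ n)"
    show "f (rotate1 w) = f w"
    proof (cases w)
      case (Cons g v)
      then have g: "g \<in> carrier G" and v: "set v \<subseteq> carrier G" using w by (auto simp: words_def)
      have "foldr (\<otimes>) (rotate1 w) \<one> = foldr (\<otimes>) v \<one> \<otimes> g"
        using Cons foldr_mult_snoc[OF v g] by simp
      moreover have "foldr (\<otimes>) v \<one> \<otimes> g = \<one> \<longleftrightarrow> g \<otimes> foldr (\<otimes>) v \<one> = \<one>"
        using g foldr_mult_closed[OF v] by (metis inv_comm)
      ultimately show ?thesis using Cons by (simp add: f_def mult.commute)
    qed simp
  qed simp
  \<comment> \<open>The constant word in \<open>x\<close> has product \<open>x [^] (p ^ n)\<close>,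
    which is \<open>\<one>\<close> exactly when \<open>x\<close> is a p-element.\<close>
  also have "\<dots> = (\<Sum>x\<in>carrier G. (if x \<in> p_elements G p then a x else 0) ^ (p ^ n))"
  proof (rule sum.cong)
    fix x assume x: "x \<in> carrier G"
    show "f (replicate (p ^ n) x) = (if x \<in> p_elements G p then a x else 0) ^ (p ^ n)"
      using pos x unfolding f_def p_elements_uniform[OF p n] foldr_mult_replicate[OF x]
      by (simp add: map_replicate prod_list_replicate power_0_left)
  qed simp
  also have "\<dots> = (\<Sum>x\<in>carrier G. if x \<in> p_elements G p then a x else 0) ^ (p ^ n)"
    using p char by (simp add: freshmans_dream_sum')
  \<comment> \<open>The coefficient at \<open>\<one>\<close> pairs \<open>x\<close> with
    \<open>inv x\<close>, and inversion preserves the set of p-elements.\<close>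
  also have "(\<Sum>x\<in>carrier G. if x \<in> p_elements G p then a x else 0) = (a \<star> psum p) \<one>"
  proof -
    have "inv x \<in> p_elements G p \<longleftrightarrow> x \<in> p_elements G p" if "x \<in> carrier G" for x
      using that by (simp add: p_elements_def)
    then show ?thesis
      unfolding ga_mult_apply[OF one_closed] p_elem_sum_def by (intro sum.cong) simp_all
  qed
  finally show ?thesis .
qed

section \<open>Traces of two-sided multiplications\<close>

text \<open>The coefficients of \<open>x \<star> (ga_basis y \<star> b)\<close> form the matrix of
  \<open>v \<mapsto> x v b\<close> in the basis of group elements; here it is applied to the vector
  \<open>c\<close>.\<close>

lemma bimult_expand:
  assumes t: "t \<in> carrier G"
  shows "(\<Sum>y\<in>carrier G. (x \<star> (ga_basis y \<star> b)) t * c y) = (x \<star> (c \<star> b)) t"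
proof -
  have "(\<Sum>y\<in>carrier G. (x \<star> (ga_basis y \<star> b)) t * c y)
      = (\<Sum>y\<in>carrier G. \<Sum>h\<in>carrier G. x h * (c y * b (inv y \<otimes> (inv h \<otimes> t))))"
    using t by (simp add: ga_mult_apply[of t] ga_basis_mult sum_distrib_right sum_distrib_left mult_ac)
  also have "\<dots> = (\<Sum>h\<in>carrier G. \<Sum>y\<in>carrier G. x h * (c y * b (inv y \<otimes> (inv h \<otimes> t))))"
    by (rule sum.swap)
  also have "\<dots> = (x \<star> (c \<star> b)) t"
    using t by (simp add: ga_mult_apply sum_distrib_left)
  finally show ?thesis .
qed

text \<open>The \<open>k\<close>-th power of \<open>v \<mapsto> x v b\<close> is
  \<open>v \<mapsto> x^k v b^k\<close>; \<open>n\<close> inner vertices correspond to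
  \<open>k = n + 1\<close>.\<close>

lemma walk_sum_bimult:
  assumes "x \<in> group_alg G" "b \<in> group_alg G" "s \<in> carrier G" "t \<in> carrier G"
  shows "(\<Sum>ys\<in>words (carrier G) n. walk_weight (\<lambda>s t. (x \<star> (ga_basis t \<star> b)) s) s ys t)
       = (ga_pow x (Suc n) \<star> (ga_basis t \<star> ga_pow b (Suc n))) s"
  using assms(3)
proof (induction n arbitrary: s)
  case 0
  then show ?case using assms by (simp add: ga_one_right)
next
  case (Suc n)
  have "(\<Sum>ys\<in>words (carrier G) (Suc n). walk_weight (\<lambda>s t. (x \<star> (ga_basis t \<star> b)) s) s ys t)
      = (\<Sum>y\<in>carrier G. (x \<star> (ga_basis y \<star> b)) s * (ga_pow x (Suc n) \<star> (ga_basis t \<star> ga_pow b (Suc n))) y)"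
    using Suc.IH by (simp add: sum_words_Suc sum_distrib_left[symmetric])
  also have "\<dots> = (x \<star> ((ga_pow x (Suc n) \<star> (ga_basis t \<star> ga_pow b (Suc n))) \<star> b)) s"
    using Suc.prems by (rule bimult_expand)
  \<comment> \<open>The new factor \<open>b\<close> arrives on the right of the power of
    \<open>b\<close>, with which it commutes.\<close>
  also have "\<dots> = (ga_pow x (Suc (Suc n)) \<star> (ga_basis t \<star> ga_pow b (Suc (Suc n)))) s"
    by (simp only: ga_mult_assoc ga_pow_commute[OF assms(2)] mult_pow.simps(2)[of _ _ _ "Suc n"])
  finally show ?case .
qed

text \<open>The left side is the trace of \<open>v \<mapsto> x v b\<close>. Exchanging the sums
  collects the conjugates of \<open>b\<close> into its trace.\<close>

lemma bimult_trace:
  "(\<Sum>y\<in>carrier G. (x \<star> (ga_basis y \<star> b)) y) = (x \<star> ga_trace b) \<one>"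
proof -
  have "(\<Sum>y\<in>carrier G. (x \<star> (ga_basis y \<star> b)) y)
      = (\<Sum>y\<in>carrier G. \<Sum>h\<in>carrier G. x h * b (inv y \<otimes> (inv h \<otimes> y)))"
    by (simp add: ga_mult_apply[of _ x] ga_basis_mult)
  also have "\<dots> = (\<Sum>h\<in>carrier G. \<Sum>y\<in>carrier G. x h * b (inv y \<otimes> (inv h \<otimes> y)))"
    by (rule sum.swap)
  also have "\<dots> = (x \<star> ga_trace b) \<one>"
    by (simp add: ga_mult_apply ga_trace_def ga_conj_def sum_distrib_left m_assoc)
  finally show ?thesis .
qed

text \<open>Both sides are traces of the linear map \<open>v \<mapsto> x v b\<close> on the group algebra and of its powers.\<close>

lemma trace_coeff_one_power:
  fixes x b :: "'a \<Rightarrow> 'f::field"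
  assumes p: "prime p" and char: "CHAR('f) = p"
    and x: "x \<in> group_alg G" and b: "b \<in> group_alg G"
  shows "((x \<star> ga_trace b) \<one>) ^ (p ^ n) = (ga_pow x (p ^ n) \<star> ga_trace (ga_pow b (p ^ n))) \<one>"
proof -
  obtain k where k: "p ^ n = Suc k" using p by (metis not0_implies_Suc power_not_zero not_prime_0)
  \<comment> \<open>\<open>bimult_trace\<close> is used twice: for the matrix of \<open>x\<close>
    and \<open>b\<close>, and for its power, which is the matrix of the corresponding powers of
    \<open>x\<close> and \<open>b\<close>.\<close>
  show ?thesis
    using sum_closed_walks[OF p char finite_carrier k, of "\<lambda>s t. (x \<star> (ga_basis t \<star> b)) s"]
      walk_sum_bimult[OF x b, of _ _ k]
    unfolding k by (simp del: mult_pow.simps add: bimult_trace)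
qed

end

section \<open>Blocks of defect zero\<close>

lemma vector_space_fun: "vector_space (\<lambda>(c::'f::field) (a::'g \<Rightarrow> 'f) x. c * a x)"
  by standard (auto simp: fun_eq_iff algebra_simps)

lemma sum_fun_apply: "(\<Sum>i\<in>A. f i) x = (\<Sum>i\<in>A. f i x :: 'f::comm_monoid_add)"
  by (induction A rule: infinite_finite_induct) auto

text \<open>Injectivity is asked on \<open>U\<close> because inflation forgets the values of a
  function outside the set of cosets. The span of a basis of \<open>V\<close> stays inside the
  subspace \<open>U\<close>.\<close>

lemma fdim_linear_image:
  fixes f :: "('g \<Rightarrow> 'f::field) \<Rightarrow> ('h \<Rightarrow> 'f)"
  assumes lin: "Vector_Spaces.linear (\<lambda>c a x. c * a x) (\<lambda>c a x. c * a x) f"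
    and inj: "inj_on f U" and U: "module.subspace (\<lambda>c a x. c * a x) U" and V: "V \<subseteq> U"
  shows "fdim (f ` V) = fdim V"
proof -
  interpret Vector_Spaces.linear "\<lambda>(c::'f) (a::'g \<Rightarrow> 'f) x. c * a x" "\<lambda>(c::'f) (a::'h \<Rightarrow> 'f) x. c * a x" f
    by (rule lin)
  obtain B where B: "B \<subseteq> V" "vs1.independent B" "V \<subseteq> vs1.span B" "card B = vs1.dim V"
    using vs1.basis_exists .
  have "vs1.span B \<subseteq> U" using B(1) V U by (intro vs1.span_minimal) auto
  then have injB: "inj_on f (vs1.span B)" using inj inj_on_subset by blast
  have "vs2.dim (f ` V) = card (f ` B)"
  proof (rule vs2.dim_unique)
    show "f ` B \<subseteq> f ` V" using B(1) by (rule image_mono)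
    show "f ` V \<subseteq> vs2.span (f ` B)" using B(3) by (auto simp: span_image)
    show "vs2.independent (f ` B)" using B(2) injB by (rule independent_injective_image)
  qed simp
  also have "card (f ` B) = card B"
    using injB vs1.span_superset by (intro card_image) (rule inj_on_subset)
  finally show ?thesis using B(4) by (simp add: fdim_def)
qed

lemma group_alg_subspace:
  "module.subspace (\<lambda>(c::'f::field) (a::'g \<Rightarrow> 'f) x. c * a x) (group_alg H)"
proof -
  interpret vector_space "\<lambda>(c::'f) (a::'g \<Rightarrow> 'f) x. c * a x" by (rule vector_space_fun)
  show ?thesis by (rule subspaceI) (auto simp: group_alg_def)
qed

context finite_group
begin

lemma center_comm_algebra:
  assumes "alg_closed TYPE('f::field)"
  shows "comm_algebra (\<lambda>(c::'f) a x. c * a x) (ga_mult G) (ga_basis \<one>) (ga_center G)"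
proof -
  interpret vector_space "\<lambda>(c::'f) (a::'a \<Rightarrow> 'f) x. c * a x" by (rule vector_space_fun)
  show ?thesis
  proof
    fix a b c :: "'a \<Rightarrow> 'f" and k
    show "(a \<star> b) \<star> c = a \<star> (b \<star> c)" by (rule ga_mult_assoc)
    show "(a + b) \<star> c = a \<star> c + b \<star> c" by (rule ga_mult_add_left)
    show "(\<lambda>x. k * a x) \<star> b = (\<lambda>x. k * (a \<star> b) x)" by (rule ga_mult_scale_left)
    show "a \<star> b = b \<star> a" if "a \<in> ga_center G" using that by (rule center_commute)
    show "a \<star> b \<in> ga_center G" if "a \<in> ga_center G" "b \<in> ga_center G"
      using that by (rule center_mult)
    show "ga_basis \<one> \<in> (ga_center G :: ('a \<Rightarrow> 'f) set)"
      by (simp add: ga_center_def ga_one_left ga_one_right)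
    show "ga_basis \<one> \<star> a = a" if "a \<in> ga_center G"
      using that by (simp add: ga_one_left ga_center_def)
    show "subspace (ga_center G)"
      by (rule subspaceI) (auto simp: center_iff_class_fun class_fun_def group_alg_def)
    have "a \<in> span (ga_basis ` carrier G)" if "a \<in> ga_center G" for a
    proof -
      have "a = (\<Sum>g\<in>carrier G. (\<lambda>x. a g * ga_basis g x))"
      proof (rule ext)
        fix x
        have "(\<Sum>g\<in>carrier G. a g * ga_basis g x) = (if x \<in> carrier G then a x else 0)"
          by (simp add: ga_basis_def if_distrib[of "\<lambda>k. _ * k"] cong: if_cong)
        also have "\<dots> = a x" using that by (simp add: ga_center_def group_alg_def)
        finally show "a x = (\<Sum>g\<in>carrier G. (\<lambda>x. a g * ga_basis g x)) x"
          by (simp add: sum_fun_apply)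
      qed
      also have "\<dots> \<in> span (ga_basis ` carrier G)"
        by (intro span_sum span_scale span_base imageI)
      finally show ?thesis .
    qed
    then show "\<exists>B. finite B \<and> ga_center G \<subseteq> span B"
      by (intro exI[of _ "ga_basis ` carrier G"]) auto
    show "alg_closed TYPE('f)" by (rule assms)
  qed
qed

section \<open>Nilpotent central elements\<close>

text \<open>One exponent is large enough both to detect the p-elements and to kill a given nilpotent
  element.\<close>

lemma exponent_above:
  fixes p N :: nat
  assumes "prime p"
  obtains n where "card (carrier G) \<le> n" "N \<le> p ^ n"
proof -
  define n where "n = max (card (carrier G)) N"
  have "n < p ^ n" using assms by (intro power_gt_expt) (simp add: prime_gt_Suc_0_nat)
  then show ?thesis using that[of n] by (simp add: n_def)
qed

text \<open>For every \<open>x\<close> a large power of \<open>x \<star> z\<close> vanishes, so by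
  \<open>ga_pow_coeff_one\<close> the product \<open>x \<star> z \<star> psum p\<close> has
  coefficient 0 at \<open>\<one>\<close>; nondegeneracy concludes.\<close>

lemma nilpotent_mult_psum:
  fixes z :: "'a \<Rightarrow> 'f::field"
  assumes p: "prime p" and char: "CHAR('f) = p"
    and z: "z \<in> ga_center G" and nil: "ga_pow z N = 0"
  shows "z \<star> psum p = 0"
proof (rule ccontr)
  assume "z \<star> psum p \<noteq> 0"
  then obtain x where x: "x \<in> group_alg G" "(x \<star> (z \<star> psum p)) \<one> \<noteq> 0"
    using ga_nondegenerate[OF group_alg_mult] by blast
  obtain n where n: "card (carrier G) \<le> n" "N \<le> p ^ n" using exponent_above[OF p] .
  have "ga_pow (x \<star> z) (p ^ n) = 0"
    using ga_pow_zero_mono[OF nil n(2)] by (simp add: ga_pow_mult_center[OF x(1) z])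
  then have "((x \<star> z \<star> psum p) \<one>) ^ (p ^ n) = 0"
    using ga_pow_coeff_one[OF p char n(1), of "x \<star> z"] by simp
  then show False using x(2) by (simp add: ga_mult_assoc)
qed

text \<open>The same argument with \<open>trace_coeff_one_power\<close>: the coefficient of
  \<open>x \<star> j \<star> ga_trace b\<close> at \<open>\<one>\<close> vanishes for every
  \<open>x\<close>, and the trace acts on \<open>j\<close> as the identity.\<close>

lemma nilpotent_below_trace_idem:
  fixes j b :: "'a \<Rightarrow> 'f::field"
  assumes p: "prime p" and char: "CHAR('f) = p"
    and j: "j \<in> ga_center G" and nil: "ga_pow j N = 0"
    and b: "b \<in> group_alg G" and je: "j \<star> ga_trace b = j"
  shows "j = 0"
proof (rule ccontr)
  assume "j \<noteq> 0"
  then obtain x where x: "x \<in> group_alg G" "(x \<star> j) \<one> \<noteq> 0"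
    using ga_nondegenerate[OF center_group_alg[OF j]] by blast
  obtain n where n: "N \<le> p ^ n" using exponent_above[OF p] by blast
  have "((x \<star> j \<star> ga_trace b) \<one>) ^ (p ^ n) = 0"
    using ga_pow_zero_mono[OF nil n]
    by (simp add: trace_coeff_one_power[OF p char group_alg_mult b] ga_pow_mult_center[OF x(1) j])
  then show False using x(2) je by (simp add: ga_mult_assoc)
qed

text \<open>This is the case of a trivial normal subgroup. \<open>dim_ideal_times\<close> applies to
  the image of the trace and \<open>psum p\<close>; the point left to show is that
  \<open>psum p\<close> does not annihilate a block idempotent which is a trace.\<close>

theorem fdim_trace_psum:
  fixes p :: nat
  assumes ac: "alg_closed TYPE('f::field)" and p: "prime p" and char: "CHAR('f) = p"
  shows "fdim ((\<lambda>a. ga_trace (a \<star> psum p)) ` (group_alg G :: ('a \<Rightarrow> 'f) set))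
    = card {e :: 'a \<Rightarrow> 'f. block_idem G e \<and> e \<in> ga_trace ` group_alg G}"
proof -
  interpret Z: comm_algebra "\<lambda>(c::'f) a x. c * a x" "ga_mult G" "ga_basis \<one>" "ga_center G"
    using ac by (rule center_comm_algebra)
  have idem: "Z.idem e \<longleftrightarrow> central_idem G e" for e
    by (simp add: Z.idem_def central_idem_def)
  have prim: "Z.prim e \<longleftrightarrow> block_idem G e" for e
    by (simp add: Z.prim_def block_idem_def idem zero_fun_def plus_fun_def)
  define I where "I = ga_trace ` (group_alg G :: ('a \<Rightarrow> 'f) set)"
  have thetaZ: "(psum p :: 'a \<Rightarrow> 'f) \<in> ga_center G" using p by (rule psum_center)
  have "Z.dim ((\<lambda>a. a \<star> psum p) ` I) = card {e. Z.prim e \<and> e \<in> I}"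
  proof (rule Z.dim_ideal_times[OF _ _ thetaZ])
    show "I \<subseteq> ga_center G" by (auto simp: I_def trace_center)
    show "a \<star> z \<in> I" if "a \<in> I" "z \<in> ga_center G" for a z
      using that by (auto simp: I_def trace_mult_center)
    show "z \<star> psum p = 0" if "z \<in> ga_center G" "Z.nilp z" for z
      using that nilpotent_mult_psum[OF p char] by (auto simp: Z.nilp_def)
  next
    fix e assume e: "Z.prim e" "e \<in> I"
    then have eZ: "e \<in> ga_center G" "e \<star> e = e" "e \<noteq> 0" by (auto simp: Z.prim_def Z.idem_def)
    have eA: "e \<in> group_alg G" using eZ(1) by (rule center_group_alg)
    obtain b where b: "b \<in> group_alg G" "e = ga_trace b" using e by (auto simp: I_def)
    obtain x where x: "x \<in> group_alg G" "(x \<star> e) \<one> \<noteq> 0"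
      using ga_nondegenerate[OF eA eZ(3)] by blast
    obtain n where n: "card (carrier G) \<le> n" using exponent_above[OF p] by blast
    have q: "p ^ n > 0" using p by (simp add: prime_gt_0_nat)
    define y where "y = ga_pow x (p ^ n) \<star> e"
    have y: "ga_pow (x \<star> e) (p ^ n) = y"
      by (simp add: ga_pow_mult_center[OF x(1) eZ(1)] ga_pow_idem[OF eA eZ(2) q] y_def)
    define z where "z = ga_trace (ga_pow b (p ^ n))"
    have zZ: "z \<in> ga_center G" by (simp add: z_def trace_center)
    \<comment> \<open>The element \<open>x \<star> e \<star> ga_trace b\<close> is
      \<open>x \<star> e\<close>, so the trace identity shows that \<open>y \<star> z\<close> has a
      nonzero coefficient at \<open>\<one>\<close>.\<close>
    have "((x \<star> e \<star> ga_trace b) \<one>) ^ (p ^ n) = (y \<star> z) \<one>"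
      by (simp add: trace_coeff_one_power[OF p char group_alg_mult b(1)] y z_def)
    moreover have "x \<star> e \<star> ga_trace b = x \<star> e" using eZ(2) b(2) by (simp add: ga_mult_assoc)
    ultimately have yz: "(y \<star> z) \<one> \<noteq> 0" using x(2) by auto
    have zeZ: "z \<star> e \<in> ga_center G" using zZ eZ(1) by (rule center_mult)
    have "(z \<star> e) \<star> e = z \<star> e" using eZ(2) by (simp add: ga_mult_assoc)
    then obtain c where c: "Z.nilp (z \<star> e - (\<lambda>x. c * e x))"
      using Z.prim_scalar_plus_nilp[OF e(1) zeZ] by blast
    \<comment> \<open>The nilpotent part is fixed by \<open>e\<close>, which is a trace, so it
      vanishes. Thus \<open>z\<close> multiplies \<open>y\<close> by the scalar \<open>c\<close>,
      and \<open>y\<close> itself has a nonzero coefficient at \<open>\<one>\<close>.\<close>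
    have "z \<star> e - (\<lambda>x. c * e x) = 0"
    proof -
      have "z \<star> e - (\<lambda>x. c * e x) \<in> ga_center G"
        using zeZ eZ(1) by (intro Z.Z_closed(3,4))
      moreover have "(z \<star> e - (\<lambda>x. c * e x)) \<star> ga_trace b = z \<star> e - (\<lambda>x. c * e x)"
        using eZ(2) by (simp add: Z.m_diff_left ga_mult_scale_left ga_mult_assoc b(2)[symmetric])
      ultimately show ?thesis
        using c nilpotent_below_trace_idem[OF p char _ _ b(1)] unfolding Z.nilp_def by blast
    qed
    then have "z \<star> e = (\<lambda>x. c * e x)" by simp
    then have "y \<star> z = (\<lambda>x. c * y x)"
      using center_commute[OF zZ, of e] by (simp add: y_def ga_mult_assoc ga_mult_scale_right)
    then have "y \<one> \<noteq> 0" using yz by auto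
    \<comment> \<open>Since \<open>y\<close> is the power of \<open>x \<star> e\<close> with
      exponent \<open>p ^ n\<close>, the word identity transfers nonvanishing to
      \<open>psum p\<close>.\<close>
    then have "((x \<star> e \<star> psum p) \<one>) ^ (p ^ n) \<noteq> 0"
      using ga_pow_coeff_one[OF p char n, of "x \<star> e"] y by simp
    then have "(x \<star> (e \<star> psum p)) \<one> \<noteq> 0" using q by (auto simp: ga_mult_assoc)
    then show "e \<star> psum p \<noteq> 0" by auto
  qed
  moreover have "(\<lambda>a. a \<star> psum p) ` I = (\<lambda>a. ga_trace (a \<star> psum p)) ` group_alg G"
    unfolding I_def image_image by (simp add: trace_mult_center[OF thetaZ])
  ultimately show ?thesis by (simp add: fdim_def prim I_def)
qed

lemma rel_trace_trivial: "rel_trace G {\<one>} (carrier G) a = ga_trace a"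
proof -
  have "{x <# {\<one>} | x. x \<in> carrier G} = (\<lambda>x. {x}) ` carrier G"
    by (force simp: l_coset_def image_iff)
  then show ?thesis
    unfolding rel_trace_def ga_trace_def by (simp add: sum.reindex)
qed

text \<open>The trivial subgroup fixes every element and contains no smaller subgroup, so
  \<open>defect_group\<close> reduces to its trace condition.\<close>

lemma defect_zero_block_iff:
  "defect_zero_block G e \<longleftrightarrow> block_idem G e \<and> e \<in> ga_trace ` group_alg G"
proof -
  have "ga_fixed G {\<one>} = group_alg G"
    by (auto simp: ga_fixed_def ga_conj_def group_alg_def fun_eq_iff)
  moreover have "R = {\<one>}" if "subgroup R G" "R \<subseteq> {\<one>}" for R
    using that subgroup.one_closed by blast
  ultimately have "defect_group G e {\<one>} \<longleftrightarrow> e \<in> ga_trace ` group_alg G"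
    using triv_subgroup unfolding defect_group_def by (auto simp: rel_trace_trivial)
  then show ?thesis by (simp add: defect_zero_block_def)
qed

end

section \<open>Inflation from the factor group\<close>

locale finite_group_normal = finite_group G + normal Q G for G (structure) and Q
begin

abbreviation H where "H \<equiv> G Mod Q"

abbreviation proj :: "'a \<Rightarrow> 'a set" where "proj x \<equiv> Q #> x"

sublocale H: finite_group H
proof -
  interpret H: group H by (rule factorgroup_is_group)
  show "finite_group H" by unfold_locales (simp add: carrier_FactGroup)
qed

sublocale proj: group_hom G H proj
  by unfold_locales (rule r_coset_hom_Mod)

text \<open>In the group algebras a coset is sent to the sum of its elements; the image consists of
  functions constant on cosets of \<open>Q\<close>.\<close>

definition inflate :: "('a set \<Rightarrow> 'f::field) \<Rightarrow> 'a \<Rightarrow> 'f" where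
  "inflate b x = (if x \<in> carrier G then b (proj x) else 0)"

text \<open>The linear extension of \<open>proj\<close> to the group algebras.\<close>

definition push :: "('a \<Rightarrow> 'f::field) \<Rightarrow> 'a set \<Rightarrow> 'f" where
  "push a C = (\<Sum>y | y \<in> carrier G \<and> proj y = C. a y)"

lemma inflate_group_alg [simp]: "inflate b \<in> group_alg G"
  by (simp add: group_alg_def inflate_def)

lemma inflate_inj: "inj_on inflate (group_alg H :: ('a set \<Rightarrow> 'f::field) set)"
proof (rule inj_onI)
  fix a b :: "'a set \<Rightarrow> 'f"
  assume ab: "a \<in> group_alg H" "b \<in> group_alg H" "inflate a = inflate b"
  show "a = b"
  proof (rule H.group_alg_eqI[OF ab(1,2)])
    fix C assume "C \<in> carrier H"
    then obtain x where "x \<in> carrier G" "C = proj x" by (auto simp: carrier_FactGroup)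
    then show "a C = b C" using fun_cong[OF ab(3), of x] by (simp add: inflate_def)
  qed
qed

lemma inflate_linear: "Vector_Spaces.linear (\<lambda>(c::'f::field) a x. c * a x) (\<lambda>c a x. c * a x) inflate"
  by (auto simp: Vector_Spaces.linear_iff vector_space_fun inflate_def fun_eq_iff)

text \<open>Grouping the sum over \<open>G\<close> by cosets shows that inflation is linear over
  \<open>FG\<close>, which acts on \<open>FH\<close> through \<open>push\<close>.\<close>

lemma mult_inflate: "a \<star> inflate c = inflate (ga_mult H (push a) c)"
proof (rule group_alg_eqI)
  fix x assume x: "x \<in> carrier G"
  have "(a \<star> inflate c) x = (\<Sum>y\<in>carrier G. a y * c (inv\<^bsub>H\<^esub> (proj y) \<otimes>\<^bsub>H\<^esub> proj x))"
    unfolding ga_mult_apply[OF x] using x by (intro sum.cong) (simp_all add: inflate_def)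
  also have "\<dots> = (\<Sum>C\<in>carrier H. \<Sum>y | y \<in> carrier G \<and> proj y = C.
      a y * c (inv\<^bsub>H\<^esub> (proj y) \<otimes>\<^bsub>H\<^esub> proj x))"
    by (rule sum.group[symmetric]) auto
  also have "\<dots> = (\<Sum>C\<in>carrier H. push a C * c (inv\<^bsub>H\<^esub> C \<otimes>\<^bsub>H\<^esub> proj x))"
    unfolding push_def sum_distrib_right by (intro sum.cong) auto
  also have "\<dots> = inflate (ga_mult H (push a) c) x"
    using x by (simp add: inflate_def H.ga_mult_apply)
  finally show "(a \<star> inflate c) x = inflate (ga_mult H (push a) c) x" .
qed simp_all

lemma push_outside: "C \<notin> carrier H \<Longrightarrow> push a C = 0"
  unfolding push_def by (intro sum.neutral) auto

lemma push_surj: "push ` group_alg G = (group_alg H :: ('a set \<Rightarrow> 'f::field) set)"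
proof (intro equalityI subsetI)
  fix b :: "'a set \<Rightarrow> 'f" assume "b \<in> push ` group_alg G"
  then show "b \<in> group_alg H" by (auto simp: group_alg_def push_outside)
next
  fix b :: "'a set \<Rightarrow> 'f" assume b: "b \<in> group_alg H"
  \<comment> \<open>Placing the coefficient of each coset on one chosen representative gives a
    preimage under \<open>push\<close>.\<close>
  define r where "r C = (SOME y. y \<in> carrier G \<and> proj y = C)" for C
  have r: "r C \<in> carrier G \<and> proj (r C) = C" if "C \<in> carrier H" for C
  proof -
    have "\<exists>y. y \<in> carrier G \<and> proj y = C" using that by (auto simp: carrier_FactGroup)
    then show ?thesis unfolding r_def by (rule someI_ex)
  qed
  define a where "a x = (if x \<in> carrier G \<and> r (proj x) = x then b (proj x) else 0)" for x
  have "push a = b"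
  proof
    fix C
    show "push a C = b C"
    proof (cases "C \<in> carrier H")
      case True
      have "push a C = (\<Sum>y | y \<in> carrier G \<and> proj y = C. if y = r C then b C else 0)"
        unfolding push_def using r[OF True] by (intro sum.cong) (auto simp: a_def)
      also have "\<dots> = b C"
      proof -
        have "finite {y. y \<in> carrier G \<and> proj y = C}" by simp
        then show ?thesis using r[OF True] by (simp add: sum.delta)
      qed
      finally show ?thesis .
    next
      case False
      then show ?thesis using b by (simp add: push_outside H.group_alg_outside)
    qed
  qed
  moreover have "a \<in> group_alg G" by (simp add: group_alg_def a_def)
  ultimately show "b \<in> push ` group_alg G" by blast
qed

text \<open>If \<open>x [^] (p ^ k)\<close> lies in \<open>Q\<close>, a further power with exponent
  \<open>card Q = p ^ m\<close> is \<open>\<one>\<close>; hence the p-elements of \<open>G\<close>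
  are the full preimage of those of \<open>H\<close>.\<close>

lemma inflate_psum:
  assumes p: "prime p" and Q: "card Q = p ^ m"
  shows "inflate (p_elem_sum H p) = psum p"
proof -
  have "proj x \<in> p_elements H p \<longleftrightarrow> x \<in> p_elements G p" if x: "x \<in> carrier G" for x
  proof -
    have pow: "proj x [^]\<^bsub>H\<^esub> k = proj (x [^] k)" for k :: nat
      using x by (simp add: proj.hom_nat_pow)
    have "(\<exists>k. proj (x [^] (p ^ k)) = Q) \<longleftrightarrow> (\<exists>k. x [^] (p ^ k) = \<one>)"
    proof
      assume "\<exists>k. proj (x [^] (p ^ k)) = Q"
      then obtain k where "proj (x [^] (p ^ k)) = Q" by blast
      then have xQ: "x [^] (p ^ k) \<in> Q"
        using rcos_self[OF nat_pow_closed[OF x] subgroup_axioms, of "p ^ k"] by simp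
      interpret S: group "G\<lparr>carrier := Q\<rparr>" by (rule subgroup_imp_group[OF subgroup_axioms])
      have "(x [^] (p ^ k)) [^]\<^bsub>G\<lparr>carrier := Q\<rparr>\<^esub> (p ^ m) = \<one>"
        using S.pow_order_eq_1[of "x [^] (p ^ k)"] xQ Q by (simp add: Coset.order_def)
      then have "(x [^] (p ^ k)) [^] (p ^ m) = \<one>"
        by (simp add: nat_pow_consistent[symmetric])
      then have "x [^] (p ^ (k + m)) = \<one>" using x by (simp add: nat_pow_pow power_add)
      then show "\<exists>k. x [^] (p ^ k) = \<one>" by blast
    next
      assume "\<exists>k. x [^] (p ^ k) = \<one>"
      then obtain k where "x [^] (p ^ k) = \<one>" by blast
      then have "proj (x [^] (p ^ k)) = Q" using proj.hom_one by simp
      then show "\<exists>k. proj (x [^] (p ^ k)) = Q" by blast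
    qed
    then show ?thesis
      unfolding p_elements_iff[OF p] H.p_elements_iff[OF p] using x by (simp add: pow)
  qed
  then show ?thesis
    by (auto simp: inflate_def p_elem_sum_def fun_eq_iff p_elements_def)
qed

text \<open>Conjugating \<open>inflate b\<close> by \<open>x\<close> depends only on the coset of
  \<open>x\<close>, so the choice of representatives in \<open>rel_trace\<close> is
  harmless.\<close>

lemma rel_trace_inflate: "rel_trace G Q (carrier G) (inflate b) = inflate (H.ga_trace b)"
proof (rule ext)
  fix h
  show "rel_trace G Q (carrier G) (inflate b) h = inflate (H.ga_trace b) h"
  proof (cases "h \<in> carrier G")
    case True
    \<comment> \<open>By normality the left cosets indexing the trace are the right cosets that make
      up the factor group.\<close>
    have cosets: "{x <# Q | x. x \<in> carrier G} = carrier H"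
      using coset_eq by (auto simp: carrier_FactGroup)
    have "ga_conj G (SOME x. x \<in> C) (inflate b) h = ga_conj H C b (proj h)" if C: "C \<in> carrier H" for C
    proof -
      obtain y where y: "y \<in> carrier G" "C = proj y" using C by (auto simp: carrier_FactGroup)
      define r where "r = (SOME x. x \<in> C)"
      have "y \<in> C" using y rcos_self subgroup_axioms by simp
      then have rC: "r \<in> proj y" unfolding r_def y(2) by (rule someI[of "\<lambda>x. x \<in> proj y"])
      then have r: "r \<in> carrier G" using y elemrcos_carrier[OF is_group] by blast
      have "proj r = C" using repr_independence[OF rC y(1) subgroup_axioms] y by simp
      then show ?thesis
        using r True C unfolding r_def[symmetric] ga_conj_def by (simp add: inflate_def)
    qed
    then show ?thesis
      using True unfolding rel_trace_def cosets by (simp add: inflate_def H.ga_trace_def)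
  next
    case False
    then show ?thesis by (simp add: rel_trace_def ga_conj_def inflate_def)
  qed
qed

text \<open>The three compatibilities of \<open>inflate\<close>, with \<open>psum\<close>,
  multiplication and trace, carry the computation to \<open>H\<close>; surjectivity of
  \<open>push\<close> yields all of \<open>group_alg H\<close>.\<close>

lemma W_ideal_eq_inflate:
  assumes "prime p" "card Q = p ^ m"
  shows "W_ideal G p Q = inflate ` (\<lambda>b. H.ga_trace (ga_mult H b (p_elem_sum H p))) ` group_alg H"
proof -
  have "W_ideal G p Q = (\<lambda>a. rel_trace G Q (carrier G) (a \<star> psum p)) ` group_alg G"
    unfolding W_ideal_def by blast
  also have "\<dots> = (\<lambda>b. inflate (H.ga_trace (ga_mult H b (p_elem_sum H p)))) ` push ` group_alg G"
    unfolding inflate_psum[OF assms, symmetric] mult_inflate rel_trace_inflate image_image ..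
  finally show ?thesis by (simp add: push_surj image_image)
qed

end

theorem theorem1:
  fixes G :: "'g monoid" and Q :: "'g set" and p :: nat
  assumes "alg_closed TYPE('f::field)"
    and "prime p" and "CHAR('f) = p"
    and "group G" and "finite (carrier G)"
    and "Q \<lhd> G" and "\<exists>k. card Q = p ^ k"
  shows "card {e :: 'g set \<Rightarrow> 'f. defect_zero_block (G Mod Q) e}
           = fdim (W_ideal G p Q :: ('g \<Rightarrow> 'f) set)"
proof -
  interpret finite_group_normal G Q
    using assms by (simp add: finite_group_normal_def finite_group_def finite_group_axioms_def)
  obtain m where m: "card Q = p ^ m" using assms(7) by blast
  have "fdim (W_ideal G p Q :: ('g \<Rightarrow> 'f) set)
      = fdim ((\<lambda>b. H.ga_trace (ga_mult H b (p_elem_sum H p))) ` (group_alg H :: ('g set \<Rightarrow> 'f) set))"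
    unfolding W_ideal_eq_inflate[OF assms(2) m]
    by (rule fdim_linear_image[OF inflate_linear inflate_inj group_alg_subspace]) auto
  also have "\<dots> = card {e :: 'g set \<Rightarrow> 'f. defect_zero_block H e}"
    unfolding H.fdim_trace_psum[OF assms(1-3)] H.defect_zero_block_iff ..
  finally show ?thesis by simp
qed

end
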